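(* Let $\gamma>0$, let $B\in\mathbb{R}^{N\times N}$ be the symmetric positive definite matrix $B=(A^T\Gamma^{-1}A+\Gamma_0^{-1})^{-1}$ and let $c=A^T\Gamma^{-1}y\in\mathbb{R}^N$. Let $m(t)=\begin{pmatrix} m_q \\ m_p \end{pmatrix}\in\mathbb{R}^{2N}$ and $C(t)=\begin{pmatrix}\mathcal{C}_q&\mathcal{C}_{q,p}\\ \mathcal{C}_{q,p}^T&\mathcal{C}_p\end{pmatrix}\in\mathbb{R}^{2N\times 2N}$ solve the ODE system $$\begin{aligned}\dot m_q&=m_p,\\ \dot m_p&=-\mathcal{C}_q(B^{-1}m_q-c)-\gamma m_p,\\ \dot{\mathcal{C}}_q&=\mathcal{C}_{q,p}+\mathcal{C}_{q,p}^T,\\ \dot{\mathcal{C}}_p&=-\mathcal{C}_qB^{-1}\mathcal{C}_{q,p}-(\mathcal{C}_qB^{-1}\mathcal{C}_{q,p})^T-2\gamma\,\mathcal{C}_p+2\gamma\,\mathcal{C}_q,\\ \dot{\mathcal{C}}_{q,p}&=-\gamma\,\mathcal{C}_{q,p}-\mathcal{C}_qB^{-1}\mathcal{C}_q+\mathcal{C}_p\end{aligned}$$ with initial conditions $m(0)=m_0$, $C(0)=C_0$. Assume that $\rho_0$ is the Gaussian density $$\rho_0(z)=\frac{1}{(2\pi)^N}(\det C_0)^{-1/2}\exp\Bigl(-\tfrac12\|z-m_0\|_{C_0}^2\Bigr),\qquad z\in\mathbb{R}^{2N},$$ with mean $m_0$ and covariance $C_0$. Then the Gaussian profile $$\rho(t,z)=\frac{1}{(2\pi)^N}(\det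 C(t))^{-1/2}\exp\Bigl(-\tfrac12\|z-m(t)\|_{C(t)}^2\Bigr)$$ solves the Fokker--Planck equation $$\partial_t\rho=\nabla\cdot\left(\begin{pmatrix}-p\\ \mathcal{C}_q(\rho)(B^{-1}q-c)+\gamma p\end{pmatrix}\rho+\begin{pmatrix}0&-\mathcal{C}_q(\rho)\\ \mathcal{C}_q(\rho)&\gamma\,\mathcal{C}_q(\rho)\end{pmatrix}\nabla\rho\right)$$ with initial condition $\rho(0,z)=\rho_0(z)$.
   Context: Here $A\in\mathbb{R}^{J\times N}$, $y\in\mathbb{R}^J$, and $\Gamma\in\mathbb{R}^{J\times J}$, $\Gamma_0\in\mathbb{R}^{N\times N}$ are symmetric positive definite. $z=(q^\top,p^\top)^\top$ with $q,p\in\mathbb{R}^N$, and $\nabla$ is the gradient in $z$. $C_0$ is symmetric positive definite. $\|x\|_C^2=\langle x,C^{-1}x\rangle$ for positive definite $C$. For a probability density $\rho$ on $\mathbb{R}^{2N}$, $\mathcal{C}_q(\rho)\in\mathbb{R}^{N\times N}$ denotes the covariance matrix of its $q$-marginal (so the Fokker--Planck equation is nonlinear and nonlocal). The assertion holds on the time interval on which the ODE solution $(m(t),C(t))$ with the given initial data exists. *)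

theory Defs
  imports "HOL-Probability.Probability"
begin

definition sym_pos_def :: "real^'k^'k \<Rightarrow> bool" where
  "sym_pos_def M \<longleftrightarrow> transpose M = M \<and> (\<forall>x. x \<noteq> 0 \<longrightarrow> x \<bullet> (M *v x) > 0)"

definition weighted_norm_sq :: "real^'k^'k \<Rightarrow> real^'k \<Rightarrow> real" where
  "weighted_norm_sq M x = x \<bullet> (matrix_inv M *v x)"

text \<open>With \<open>N = CARD('n)\<close>, phase space \<open>\<real>\<^sup>2\<^sup>N\<close> is the type \<open>real^('n + 'n)\<close>: the indices
  \<open>Inl i\<close> carry the \<open>q\<close>-components and the indices \<open>Inr i\<close> the \<open>p\<close>-components.\<close>

definition stack :: "real^'n \<Rightarrow> real^'n \<Rightarrow> real^('n + 'n)" where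
  "stack q p = (\<chi> k. case k of Inl i \<Rightarrow> q $ i | Inr i \<Rightarrow> p $ i)"

definition q_part :: "real^('n + 'n) \<Rightarrow> real^'n" where
  "q_part z = (\<chi> i. z $ Inl i)"

definition p_part :: "real^('n + 'n) \<Rightarrow> real^'n" where
  "p_part z = (\<chi> i. z $ Inr i)"

text \<open>\<open>block_mat P Q R S\<close> has top row of blocks \<open>P, Q\<close> and bottom row of blocks \<open>R, S\<close>.\<close>

definition block_mat ::
  "real^'n^'n \<Rightarrow> real^'n^'n \<Rightarrow> real^'n^'n \<Rightarrow> real^'n^'n \<Rightarrow> real^('n + 'n)^('n + 'n)" where
  "block_mat P Q R S = (\<chi> k l. case k of
      Inl i \<Rightarrow> (case l of Inl j \<Rightarrow> P $ i $ j | Inr j \<Rightarrow> Q $ i $ j)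
    | Inr i \<Rightarrow> (case l of Inl j \<Rightarrow> R $ i $ j | Inr j \<Rightarrow> S $ i $ j))"

definition gaussian_density ::
  "real^('n::finite + 'n) \<Rightarrow> real^('n + 'n)^('n + 'n) \<Rightarrow> real^('n + 'n) \<Rightarrow> real" where
  "gaussian_density m C z =
     1 / (2 * pi) ^ CARD('n) * det C powr (-1/2) * exp (-1/2 * weighted_norm_sq C (z - m))"

definition probability_density :: "(real^'k \<Rightarrow> real) \<Rightarrow> bool" where
  "probability_density f \<longleftrightarrow>
     f \<in> borel_measurable borel \<and> (\<forall>z. f z \<ge> 0) \<and> (\<integral>\<^sup>+ z. ennreal (f z) \<partial>lborel) = 1"

definition q_marginal :: "(real^('n + 'n) \<Rightarrow> real) \<Rightarrow> (real^'n) measure" where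
  "q_marginal f = distr (density lborel (\<lambda>z. ennreal (f z))) borel q_part"

definition covariance_matrix :: "(real^'k) measure \<Rightarrow> real^'k^'k" where
  "covariance_matrix M =
     (let \<mu> = (\<integral>x. x \<partial>M) in \<chi> i j. \<integral>x. (x - \<mu>) $ i * (x - \<mu>) $ j \<partial>M)"

abbreviation q_covariance :: "(real^('n + 'n) \<Rightarrow> real) \<Rightarrow> real^'n^'n" where
  "q_covariance f \<equiv> covariance_matrix (q_marginal f)"

definition grad :: "(real^'k \<Rightarrow> real) \<Rightarrow> real^'k \<Rightarrow> real^'k" where
  "grad f z = (\<chi> k. frechet_derivative f (at z) (axis k 1))"

definition divergence :: "(real^'k \<Rightarrow> real^'k) \<Rightarrow> real^'k \<Rightarrow> real" where
  "divergence F z = trace (jacobian F (at z))"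

text \<open>The vector field whose divergence is the right-hand side of the Fokker--Planck equation.\<close>

definition fokker_planck_field ::
  "real \<Rightarrow> real^'n^'n \<Rightarrow> real^'n \<Rightarrow> (real^('n + 'n) \<Rightarrow> real) \<Rightarrow> real^('n + 'n) \<Rightarrow> real^('n + 'n)" where
  "fokker_planck_field \<gamma> B c f z =
     f z *\<^sub>R stack (- p_part z) (q_covariance f *v (matrix_inv B *v q_part z - c) + \<gamma> *\<^sub>R p_part z)
     + block_mat 0 (- q_covariance f) (q_covariance f) (\<gamma> *\<^sub>R q_covariance f) *v grad f z"

text \<open>Classical solutions on a time interval \<open>I\<close> with values in the probability densities. The
  second moment condition and the differentiability conditions guarantee that the covariance, the
  gradient and the divergence, which are total functions here, are meaningful. Time derivatives
  are one-sided at end points of \<open>I\<close>.\<close>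

definition solves_fokker_planck ::
  "real \<Rightarrow> real^'n^'n \<Rightarrow> real^'n \<Rightarrow> real set \<Rightarrow> (real \<Rightarrow> real^('n + 'n) \<Rightarrow> real) \<Rightarrow> bool" where
  "solves_fokker_planck \<gamma> B c I \<rho> \<longleftrightarrow> (\<forall>t\<in>I.
     probability_density (\<rho> t) \<and>
     integrable (q_marginal (\<rho> t)) (\<lambda>q. (norm q)\<^sup>2) \<and>
     (\<forall>z. \<rho> t differentiable at z) \<and>
     (\<forall>z. fokker_planck_field \<gamma> B c (\<rho> t) differentiable at z) \<and>
     (\<forall>z. ((\<lambda>s. \<rho> s z) has_real_derivative
             divergence (fokker_planck_field \<gamma> B c (\<rho> t)) z) (at t within I)))"

end

theory Submission
  imports Defs
begin

text \<open>With the drift matrix \<open>M = ((0, I), (- C\<^sub>q B\<^sup>-\<^sup>1, - \<gamma> I))\<close>, the diffusion matrix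
  \<open>W = ((0, - C\<^sub>q), (C\<^sub>q, \<gamma> C\<^sub>q))\<close> and \<open>b = (0, C\<^sub>q c)\<close>, the moment equations read \<open>m' = M m + b\<close>
  and \<open>C' = M C + C M\<^sup>T + W + W\<^sup>T\<close>. Writing \<open>w = C\<^sup>-\<^sup>1 (z - m)\<close>, both sides of the Fokker--Planck
  equation are then equal to
  \<open>\<rho> (w \<bullet> (M z + b) + w \<bullet> W w - tr M - tr (W C\<^sup>-\<^sup>1))\<close>: the left-hand side by Jacobi's formula and
  the derivative of the inverse, the right-hand side by differentiating in \<open>z\<close>.
  This needs \<open>C(t)\<close> to stay positive definite, which follows from a barrier for the smallest
  eigenvalue, and the \<open>q\<close>-marginal of \<open>\<rho>\<close> to have covariance \<open>C\<^sub>q\<close>, which follows by writing the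
  Gaussian measure as an affine image of the standard one.\<close>

section \<open>Symmetric positive definite matrices\<close>

text \<open>The equation is nonlocal: its coefficients contain the covariance of the unknown
  density. Once that covariance is known to be \<open>C\<^sub>q t\<close>, the coefficients at time
  \<open>t\<close> are plain matrices, so the verification can be done one time at a time for a
  linear equation with given \<open>M\<close>, \<open>W\<close> and \<open>b\<close>. The
  identification needs \<open>C t\<close> positive definite, and here lies a circle:
  \<open>W t\<close> has a nonnegative quadratic form because \<open>C\<^sub>q t\<close> is positive
  definite, which is part of what has to be shown. A first contact argument breaks it, since the
  barrier is still strictly positive at the contact time. Symmetry of \<open>C t\<close> is not
  assumed for positive times either. It is derived from the moment equations before anything else,
  and both the Lyapunov form of the covariance equation and the cancellation of the off-diagonal
  blocks of \<open>W\<close> rely on it. The matrix \<open>W\<close> itself is not symmetric. Its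
  skew part cancels in \<open>W + transpose W\<close>, in \<open>w \<bullet> (W *v w)\<close> and in
  the trace of \<open>W\<close> against the symmetric inverse of \<open>C\<close>, which is why only
  the friction block feeds the covariance.\<close>

definition diagonal_matrix :: "('n \<Rightarrow> real) \<Rightarrow> real^'n^'n" where
  "diagonal_matrix d = (\<chi> i j. if i = j then d i else 0)"

lemma diagonal_matrix_mult_transpose:
  "diagonal_matrix a ** transpose (diagonal_matrix b) = diagonal_matrix (\<lambda>i. a i * b i)"
proof -
  have "(\<Sum>k\<in>UNIV. (if i = k then a i else 0) * (if j = k then b j else 0)) =
      (\<Sum>k\<in>UNIV. if k = i then (if i = j then a i * b i else 0) else 0)" for i j
    by (rule sum.cong) auto
  then show ?thesis
    by (simp add: matrix_matrix_mult_def transpose_def diagonal_matrix_def vec_eq_iff)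
qed

section \<open>Spectral theorem and square roots\<close>

lemma symmetric_inner:
  fixes A :: "real^'n^'n"
  assumes "transpose A = A"
  shows "(A *v x) \<bullet> y = x \<bullet> (A *v y)"
  by (metis assms dot_lmul_matrix transpose_matrix_vector)

lemma inner_transpose: "x \<bullet> (transpose A *v y) = (A *v x) \<bullet> y" for A :: "real^'n^'m"
  by (metis dot_lmul_matrix inner_commute transpose_matrix_vector)

text \<open>The equality case of Cauchy-Schwarz for a form that is only semidefinite on
  \<open>W\<close>: a nonzero mixed term would make the form negative somewhere on the line through
  \<open>x\<close> in direction \<open>h\<close>.\<close>

lemma semidefinite_form_null:
  fixes A :: "real^'n^'n"
  assumes A: "transpose A = A" and W: "subspace W"
    and nonneg: "\<And>w. w \<in> W \<Longrightarrow> 0 \<le> w \<bullet> (A *v w)"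
    and x: "x \<in> W" "x \<bullet> (A *v x) = 0" and h: "h \<in> W"
  shows "h \<bullet> (A *v x) = 0"
proof (rule ccontr)
  define a where "a = h \<bullet> (A *v x)"
  define b where "b = h \<bullet> (A *v h)"
  \<comment> \<open>The minimiser along the line would be \<open>- a / b\<close>; adding 1 to the
    denominator keeps the value negative and also covers \<open>b = 0\<close>.\<close>
  define t where "t = - a / (b + 1)"
  assume "h \<bullet> (A *v x) \<noteq> 0"
  then have a: "a \<noteq> 0" by (simp add: a_def)
  have b: "b \<ge> 0" using nonneg[OF h] by (simp add: b_def)
  have "x + t *\<^sub>R h \<in> W" using W x(1) h by (simp add: subspace_add subspace_scale)
  from nonneg[OF this] have "0 \<le> (x + t *\<^sub>R h) \<bullet> (A *v (x + t *\<^sub>R h))" .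
  also have "\<dots> = 2 * t * a + t\<^sup>2 * b"
    using x(2) symmetric_inner[OF A, of x h]
    by (simp add: a_def b_def matrix_vector_right_distrib matrix_vector_mult_scaleR inner_simps
        power2_eq_square inner_commute algebra_simps)
  also have "\<dots> = - (a\<^sup>2 * (b + 2) / (b + 1)\<^sup>2)"
    using b by (simp add: t_def divide_simps power2_eq_square) (simp add: algebra_simps)
  finally have "a\<^sup>2 * (b + 2) / (b + 1)\<^sup>2 \<le> 0" by simp
  moreover have "a\<^sup>2 * (b + 2) / (b + 1)\<^sup>2 > 0" using a b by simp
  ultimately show False by simp
qed

text \<open>Maximise the Rayleigh quotient on the unit sphere of \<open>W\<close>. With the maximum
  \<open>d\<close>, the form of \<open>d *\<^sub>R mat 1 - A\<close> is nonnegative on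
  \<open>W\<close> and vanishes at the maximiser \<open>x\<close>. Invariance of \<open>W\<close>
  allows the image of \<open>x\<close> as test vector in \<open>semidefinite_form_null\<close>, so
  this image has norm zero.\<close>

lemma symmetric_eigenvector_in_subspace:
  fixes A :: "real^'n^'n"
  assumes A: "transpose A = A" and W: "subspace W" and inv: "\<And>w. w \<in> W \<Longrightarrow> A *v w \<in> W"
    and nz: "y \<in> W" "y \<noteq> 0"
  shows "\<exists>x d. x \<in> W \<and> norm x = 1 \<and> A *v x = d *\<^sub>R x"
proof -
  let ?K = "W \<inter> sphere 0 1"
  have "compact ?K"
    by (simp add: closed_Int_compact closed_subspace W)
  moreover have "y /\<^sub>R norm y \<in> ?K"
    using nz W by (simp add: subspace_scale)
  moreover have "continuous_on ?K (\<lambda>x. x \<bullet> (A *v x))"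
    by (intro continuous_intros linear_continuous_on matrix_vector_mul_bounded_linear)
  ultimately obtain x where x: "x \<in> ?K" and max: "\<And>w. w \<in> ?K \<Longrightarrow> w \<bullet> (A *v w) \<le> x \<bullet> (A *v x)"
    using continuous_attains_sup[of ?K "\<lambda>x. x \<bullet> (A *v x)"] by (metis empty_iff)
  define d where "d = x \<bullet> (A *v x)"
  define B where "B = d *\<^sub>R mat 1 - A"
  have Bv: "B *v w = d *\<^sub>R w - A *v w" for w
    by (simp add: B_def matrix_vector_mult_diff_rdistrib flip: scaleR_matrix_vector_assoc)
  have "transpose B = B"
    using A by (auto simp: B_def transpose_def mat_def vec_eq_iff)
  moreover have "0 \<le> w \<bullet> (B *v w)" if w: "w \<in> W" for w
  proof (cases "w = 0")
    case False
    have "w /\<^sub>R norm w \<in> ?K" using False w W by (simp add: subspace_scale)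
    from max[OF this] have "(w \<bullet> (A *v w)) / (norm w)\<^sup>2 \<le> d"
      by (simp add: d_def matrix_vector_mult_scaleR power2_eq_square divide_inverse mult.assoc)
        (simp add: mult_ac)
    with False show ?thesis
      by (simp add: Bv inner_diff_right pos_divide_le_eq power2_norm_eq_inner)
  qed simp
  moreover have "x \<bullet> (B *v x) = 0"
    using x by (simp add: Bv inner_diff_right flip: d_def power2_norm_eq_inner)
  moreover have "x \<in> W" "B *v x \<in> W"
    using x inv W by (auto simp: Bv subspace_diff subspace_scale)
  ultimately have "(B *v x) \<bullet> (B *v x) = 0"
    using semidefinite_form_null[of B W x "B *v x"] W by blast
  then show ?thesis
    using x by (intro exI[of _ x] exI[of _ d]) (simp add: Bv)
qed

text \<open>Symmetry makes the orthogonal complement of eigenvectors invariant, so as long as fewer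
  than \<open>CARD('n)\<close> vectors have been found, the complement is nonzero and contains a
  further eigenvector.\<close>

lemma orthonormal_eigenvectors:
  fixes A :: "real^'n^'n"
  assumes A: "transpose A = A" and k: "k \<le> CARD('n)"
  shows "\<exists>S. finite S \<and> card S = k \<and> pairwise orthogonal S \<and>
    (\<forall>x\<in>S. norm x = 1 \<and> (\<exists>d. A *v x = d *\<^sub>R x))"
  using k
proof (induction k)
  case 0
  then show ?case by (intro exI[of _ "{}"]) auto
next
  case (Suc k)
  then obtain S where S: "finite S" "card S = k" "pairwise orthogonal S"
    and eig: "\<And>x. x \<in> S \<Longrightarrow> norm x = 1" "\<And>x. x \<in> S \<Longrightarrow> \<exists>d. A *v x = d *\<^sub>R x"
    by auto
  let ?W = "{w. \<forall>s\<in>S. orthogonal s w}"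
  have W: "subspace ?W"
    by (auto simp: subspace_def orthogonal_def inner_simps)
  have "dim S < DIM(real^'n)"
    using dim_le_card'[OF S(1)] S(2) Suc.prems by simp
  then obtain y where "y \<noteq> 0" "\<And>s. s \<in> span S \<Longrightarrow> orthogonal y s"
    using orthogonal_to_subspace_exists by blast
  then have y: "y \<in> ?W" "y \<noteq> 0"
    by (auto simp: span_base orthogonal_commute)
  have inv: "A *v w \<in> ?W" if "w \<in> ?W" for w
  proof (clarsimp simp: orthogonal_def)
    fix s assume s: "s \<in> S"
    then obtain d where "A *v s = d *\<^sub>R s" using eig by blast
    then show "s \<bullet> (A *v w) = 0"
      using symmetric_inner[OF A, of s w] that s by (simp add: orthogonal_def)
  qed
  have "\<exists>x d. x \<in> ?W \<and> norm x = 1 \<and> A *v x = d *\<^sub>R x"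
    by (rule symmetric_eigenvector_in_subspace[OF A W _ y]) (rule inv)
  then obtain x d where x: "x \<in> ?W" "norm x = 1" "A *v x = d *\<^sub>R x"
    by (elim exE conjE)
  have "x \<notin> S"
    using x by (auto simp: orthogonal_def)
  then show ?case
    using S eig x
    by (intro exI[of _ "insert x S"]) (auto simp: pairwise_insert orthogonal_commute)
qed

theorem symmetric_diagonalisation:
  fixes A :: "real^'n^'n"
  assumes A: "transpose A = A"
  shows "\<exists>Q d. orthogonal_matrix Q \<and> A = Q ** diagonal_matrix d ** transpose Q \<and>
    (\<forall>i. A *v column i Q = d i *\<^sub>R column i Q \<and> norm (column i Q) = 1)"
proof -
  obtain S where S: "finite S" "card S = CARD('n)" "pairwise orthogonal S"
    and eig: "\<And>x. x \<in> S \<Longrightarrow> norm x = 1" "\<And>x. x \<in> S \<Longrightarrow> \<exists>d. A *v x = d *\<^sub>R x"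
    using orthonormal_eigenvectors[OF A order_refl] by blast
  then obtain f where f: "bij_betw f (UNIV :: 'n set) S"
    using finite_same_card_bij[of "UNIV :: 'n set" S] by auto
  have fS: "f i \<in> S" for i using f by (auto simp: bij_betw_def)
  obtain d where d: "\<And>i. A *v f i = d i *\<^sub>R f i" using eig(2)[OF fS] by metis
  define Q where "Q = (\<chi> i j. f j $ i)"
  have col: "column i Q = f i" for i by (simp add: Q_def column_def vec_eq_iff)
  have "f i \<bullet> f j = (if i = j then 1 else 0)" for i j
  proof (cases "i = j")
    case False
    then have "f i \<noteq> f j" using f by (auto simp: bij_betw_def inj_on_def)
    then show ?thesis using S(3) fS False by (simp add: pairwise_def orthogonal_def)
  qed (use eig(1)[OF fS] in \<open>simp add: norm_eq_1\<close>)
  then have "transpose Q ** Q = mat 1"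
    by (simp add: matrix_mult_transpose_dot_column col mat_def)
  then have Q: "orthogonal_matrix Q" by (simp add: orthogonal_matrix)
  let ?D = "diagonal_matrix d"
  have "(A ** Q) $ i $ j = (Q ** ?D) $ i $ j" for i j
  proof -
    have "(A ** Q) $ i $ j = (A *v f j) $ i"
      by (simp add: matrix_matrix_mult_def matrix_vector_mult_def Q_def)
    also have "\<dots> = (Q ** ?D) $ i $ j"
      by (simp add: d diagonal_matrix_def matrix_matrix_mult_def Q_def if_distrib if_distribR sum.delta mult.commute cong: if_cong)
    finally show ?thesis .
  qed
  then have "A ** Q = Q ** ?D" by (simp add: vec_eq_iff)
  then have "Q ** ?D ** transpose Q = A ** (Q ** transpose Q)"
    by (simp add: matrix_mul_assoc)
  then have "A = Q ** ?D ** transpose Q"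
    using Q by (simp add: orthogonal_matrix_def)
  then show ?thesis
    using Q d eig(1)[OF fS] unfolding col[symmetric]
    by (intro exI[of _ Q] exI[of _ d] conjI allI)
qed

text \<open>The \<open>d i\<close> are the square roots of the eigenvalues. The factor is kept as an
  orthogonal matrix times a diagonal one because the change of variables for Lebesgue measure treats
  these two maps separately.\<close>

lemma sym_pos_def_square_root:
  fixes A :: "real^'n^'n"
  assumes "sym_pos_def A"
  shows "\<exists>Q d. orthogonal_matrix Q \<and> (\<forall>i. d i > 0) \<and>
    A = (Q ** diagonal_matrix d) ** transpose (Q ** diagonal_matrix d) \<and>
    det A = (\<Prod>i\<in>UNIV. d i)\<^sup>2"
proof -
  have A: "transpose A = A" and pos: "\<And>x. x \<noteq> 0 \<Longrightarrow> x \<bullet> (A *v x) > 0"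
    using assms by (auto simp: sym_pos_def_def)
  obtain Q e where Q: "orthogonal_matrix Q"
    and AQ: "A = Q ** diagonal_matrix e ** transpose Q"
    and "\<forall>i. A *v column i Q = e i *\<^sub>R column i Q \<and> norm (column i Q) = 1"
    using symmetric_diagonalisation[OF A] by (elim exE conjE)
  then have eig: "\<And>i. A *v column i Q = e i *\<^sub>R column i Q" "\<And>i. norm (column i Q) = 1"
    by simp_all
  have e: "e i > 0" for i
  proof -
    have "column i Q \<noteq> 0" using eig(2)[of i] by force
    from pos[OF this] show ?thesis
      using eig(2)[of i] by (simp add: eig(1) norm_eq_1)
  qed
  define d where "d i = sqrt (e i)" for i
  let ?D = "diagonal_matrix d"
  have D: "diagonal_matrix e = ?D ** transpose ?D"
    using e by (simp add: d_def diagonal_matrix_mult_transpose less_imp_le)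
  have root: "A = (Q ** ?D) ** transpose (Q ** ?D)"
    by (subst AQ, subst D) (simp only: matrix_transpose_mul matrix_mul_assoc)
  have "det ?D = (\<Prod>i\<in>UNIV. d i)" by (subst det_diagonal) (auto simp: diagonal_matrix_def)
  moreover have "det Q * det Q = 1"
    using det_orthogonal_matrix[OF Q] by (elim disjE) simp_all
  moreover have "det A = det (Q ** ?D) * det (Q ** ?D)"
    by (subst root) (simp only: det_mul det_transpose)
  ultimately have "det A = (\<Prod>i\<in>UNIV. d i)\<^sup>2"
    by (simp add: det_mul power2_eq_square mult_ac)
  moreover have "\<forall>i. d i > 0" using e by (simp add: d_def)
  ultimately show ?thesis
    using Q root by (intro exI[of _ Q] exI[of _ d] conjI)
qed

lemma sym_pos_def_det_pos:
  fixes A :: "real^'n^'n"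
  assumes "sym_pos_def A"
  shows "det A > 0"
proof -
  obtain d :: "'n \<Rightarrow> real" where "\<forall>i. d i > 0" and det: "det A = (\<Prod>i\<in>UNIV. d i)\<^sup>2"
    using sym_pos_def_square_root[OF assms] by meson
  then have "(\<Prod>i\<in>UNIV. d i) > 0" by (simp add: prod_pos)
  then show ?thesis unfolding det by (rule zero_less_power)
qed

section \<open>Inverse matrices\<close>

lemma matrix_inv_mult:
  fixes A :: "real^'n^'n"
  assumes "det A \<noteq> 0"
  shows "A ** matrix_inv A = mat 1" "matrix_inv A ** A = mat 1"
proof -
  have "invertible A" using assms by (simp add: invertible_det_nz)
  then have "A ** matrix_inv A = mat 1 \<and> matrix_inv A ** A = mat 1"
    unfolding matrix_inv_def invertible_def by (rule someI_ex)
  then show "A ** matrix_inv A = mat 1" "matrix_inv A ** A = mat 1" by blast+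
qed

lemma matrix_inv_mult_vector:
  fixes A :: "real^'n^'n"
  assumes "det A \<noteq> 0"
  shows "A *v (matrix_inv A *v x) = x" "matrix_inv A *v (A *v x) = x"
  by (simp_all add: matrix_vector_mul_assoc matrix_inv_mult[OF assms])

lemma matrix_inv_unique:
  fixes A B :: "real^'n^'n"
  assumes "B ** A = mat 1"
  shows "matrix_inv A = B"
proof -
  have "det B * det A = 1" by (simp add: assms flip: det_mul)
  then have "det A \<noteq> 0" by auto
  then have "B = B ** (A ** matrix_inv A)" by (simp add: matrix_inv_mult)
  also have "\<dots> = matrix_inv A" by (simp add: matrix_mul_assoc assms)
  finally show ?thesis by (rule sym)
qed

lemma transpose_matrix_inv:
  fixes A :: "real^'n^'n"
  assumes "transpose A = A" "det A \<noteq> 0"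
  shows "transpose (matrix_inv A) = matrix_inv A"
proof -
  have "transpose (matrix_inv A) ** A = transpose (A ** matrix_inv A)"
    by (simp add: matrix_transpose_mul assms(1))
  also have "\<dots> = mat 1" by (simp add: matrix_inv_mult assms(2))
  finally show ?thesis by (rule matrix_inv_unique[symmetric])
qed

lemma matrix_inv_matrix_inv:
  fixes A :: "real^'n^'n"
  assumes "det A \<noteq> 0"
  shows "matrix_inv (matrix_inv A) = A"
  by (rule matrix_inv_unique) (simp add: matrix_inv_mult assms)

lemma sym_pos_def_matrix_inv:
  fixes A :: "real^'n^'n"
  assumes "sym_pos_def A"
  shows "sym_pos_def (matrix_inv A)"
proof -
  have det: "det A \<noteq> 0" using sym_pos_def_det_pos[OF assms] by simp
  have "x \<bullet> (matrix_inv A *v x) > 0" if "x \<noteq> 0" for x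
  proof -
    have "matrix_inv A *v x \<noteq> 0"
      using that matrix_inv_mult_vector(1)[OF det, of x] by auto
    then have "(matrix_inv A *v x) \<bullet> (A *v (matrix_inv A *v x)) > 0"
      using assms by (simp add: sym_pos_def_def)
    then show ?thesis by (simp add: matrix_inv_mult_vector[OF det] inner_commute)
  qed
  then show ?thesis
    using assms transpose_matrix_inv[OF _ det] by (simp add: sym_pos_def_def)
qed

lemma transpose_simps:
  fixes X Y :: "'a::ab_group_add^'n^'m"
  shows "transpose (X + Y) = transpose X + transpose Y" "transpose (- X) = - transpose X"
    "transpose (X - Y) = transpose X - transpose Y" "transpose (0 :: 'a^'n^'m) = 0"
  by (simp_all add: transpose_def vec_eq_iff)

text \<open>The first summand is only semidefinite, since \<open>A\<close> may have a kernel;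
  strictness comes from \<open>matrix_inv \<Gamma>\<^sub>0\<close>.\<close>

lemma sym_pos_def_normal_matrix:
  fixes A :: "real^'n^'j"
  assumes "sym_pos_def \<Gamma>" "sym_pos_def \<Gamma>\<^sub>0"
  shows "sym_pos_def (transpose A ** matrix_inv \<Gamma> ** A + matrix_inv \<Gamma>\<^sub>0)"
proof -
  let ?G = "matrix_inv \<Gamma>" and ?H = "matrix_inv \<Gamma>\<^sub>0"
  have G: "transpose ?G = ?G" "\<And>x. x \<noteq> 0 \<Longrightarrow> x \<bullet> (?G *v x) > 0"
    using sym_pos_def_matrix_inv[OF assms(1)] by (auto simp: sym_pos_def_def)
  have H: "transpose ?H = ?H" "\<And>x. x \<noteq> 0 \<Longrightarrow> x \<bullet> (?H *v x) > 0"
    using sym_pos_def_matrix_inv[OF assms(2)] by (auto simp: sym_pos_def_def)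
  have "transpose (transpose A ** ?G ** A + ?H) = transpose A ** ?G ** A + ?H"
    by (simp add: transpose_simps matrix_transpose_mul G(1) H(1) matrix_mul_assoc)
  moreover have "x \<bullet> ((transpose A ** ?G ** A + ?H) *v x) > 0" if "x \<noteq> 0" for x
  proof -
    have "0 \<le> (A *v x) \<bullet> (?G *v (A *v x))"
      using G(2)[of "A *v x"] by (cases "A *v x = 0") (auto simp: less_imp_le)
    also have "\<dots> = x \<bullet> ((transpose A ** ?G ** A) *v x)"
      by (simp only: matrix_vector_mul_assoc[symmetric] inner_transpose)
    finally show ?thesis
      using H(2)[OF that] by (simp add: matrix_vector_mult_add_rdistrib inner_add_right)
  qed
  ultimately show ?thesis by (simp add: sym_pos_def_def)
qed

text \<open>The inverse of \<open>P ** transpose P\<close> applied to \<open>P *v u\<close> is the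
  vector \<open>y\<close> with \<open>transpose P *v y = u\<close>, so pairing it with
  \<open>P *v u\<close> gives the Euclidean square of \<open>u\<close>.\<close>

lemma weighted_norm_sq_square_root:
  fixes P :: "real^'n^'n"
  assumes "det (P ** transpose P) \<noteq> 0"
  shows "weighted_norm_sq (P ** transpose P) (P *v u) = u \<bullet> u"
proof -
  define y where "y = matrix_inv (P ** transpose P) *v (P *v u)"
  have "det P * det P \<noteq> 0" using assms by (simp add: det_mul)
  then have P: "det P \<noteq> 0" by auto
  have "P *v (transpose P *v y) = (P ** transpose P) *v y"
    by (rule matrix_vector_mul_assoc)
  also have "\<dots> = P *v u"
    unfolding y_def by (rule matrix_inv_mult_vector(1)[OF assms])
  finally have "matrix_inv P *v (P *v (transpose P *v y)) = matrix_inv P *v (P *v u)"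
    by (rule arg_cong)
  then have "transpose P *v y = u"
    by (simp only: matrix_inv_mult_vector(2)[OF P])
  then have "u \<bullet> u = (P *v u) \<bullet> y"
    using dot_lmul_matrix[of u "transpose P" y] by (simp del: transpose_matrix_vector)
  then show ?thesis by (simp add: weighted_norm_sq_def y_def)
qed

section \<open>Gaussian measures\<close>

text \<open>The library's linear change of variables requires a well-ordered index type, which \<open>'n + 'n\<close>
  is not. Instead: by Fubini, a translation invariant measure is a multiple of \<open>lborel\<close>, and the
  unit ball fixes the factor.\<close>

lemma distr_lborel_orthogonal_transformation:
  fixes f :: "'a::euclidean_space \<Rightarrow> 'a"
  assumes f: "orthogonal_transformation f"
  shows "distr lborel borel f = lborel"
proof -
  let ?M = "distr lborel borel f"
  have lin: "linear f" using f by (rule orthogonal_transformation_linear)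
  have f_meas[measurable]: "f \<in> borel_measurable borel"
    by (intro borel_measurable_continuous_onI linear_continuous_on linear_conv_bounded_linear[THEN iffD1] lin)
  have ball: "emeasure ?M (ball (0::'a) r) = emeasure lborel (ball (0::'a) r)" for r
  proof -
    have "f -` ball 0 r = ball (0::'a) r"
      using orthogonal_transformation_norm[OF f] by auto
    then show ?thesis by (simp add: emeasure_distr)
  qed
  interpret M: sigma_finite_measure ?M
  proof
    have "(\<Union>n::nat. ball (0::'a) (real n)) = UNIV"
      using reals_Archimedean2 by auto
    moreover have "emeasure ?M (ball (0::'a) (real n)) \<noteq> \<infinity>" for n
      unfolding ball using emeasure_lborel_ball_finite[of "0::'a" "real n"] by simp
    ultimately show "\<exists>A. countable A \<and> A \<subseteq> sets ?M \<and> \<Union>A = space ?M \<and> (\<forall>a\<in>A. emeasure ?M a \<noteq> \<infinity>)"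
      by (intro exI[of _ "range (\<lambda>n::nat. ball (0::'a) (real n))"]) auto
  qed
  \<comment> \<open>A translation after \<open>f\<close> is \<open>f\<close> after a translation:
    \<open>a + f x = f (b + x)\<close> when \<open>a = f b\<close>.\<close>
  have trans: "distr ?M borel ((+) a) = ?M" for a
  proof -
    obtain b where b: "a = f b"
      using orthogonal_transformation_surj[OF f] by (metis surjD)
    have "distr ?M borel ((+) a) = distr lborel borel (\<lambda>x. a + f x)"
      by (subst distr_distr) (auto simp: o_def)
    also have "(\<lambda>x. a + f x) = f \<circ> (+) b"
      by (auto simp: b linear_add[OF lin])
    also have "distr lborel borel (f \<circ> (+) b) = distr (distr lborel borel ((+) b)) borel f"
      by (subst distr_distr) (auto simp: o_def)
    finally show ?thesis by (simp only: lborel_distr_plus)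
  qed
  interpret pair_sigma_finite ?M lborel
    by (intro pair_sigma_finite.intro M.sigma_finite_measure_axioms sigma_finite_lborel)
  \<comment> \<open>Integrate the product of the indicators of \<open>A\<close> at \<open>x\<close>
    and of \<open>B\<close> at \<open>x + y\<close> in both orders. The substitutions use
    translation invariance of \<open>lborel\<close>, then of \<open>?M\<close>, and finally
    invariance of \<open>lborel\<close> under reflection and translation.\<close>
  have key: "emeasure ?M A * emeasure lborel B = emeasure ?M B * emeasure lborel A"
    if [measurable]: "A \<in> sets borel" "B \<in> sets borel" for A B
  proof -
    have "emeasure ?M A * emeasure lborel B = (\<integral>\<^sup>+x. indicator A x * emeasure lborel B \<partial>?M)"
      by (simp add: nn_integral_multc)
    also have "\<dots> = (\<integral>\<^sup>+x. (\<integral>\<^sup>+y. indicator A x * indicator B (x + y) \<partial>lborel) \<partial>?M)"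
    proof (rule nn_integral_cong)
      fix x
      have "(\<integral>\<^sup>+y. indicator B (x + y) \<partial>lborel) = (\<integral>\<^sup>+y. indicator B y \<partial>distr lborel borel ((+) x))"
        by (subst nn_integral_distr) auto
      then have "(\<integral>\<^sup>+y. indicator B (x + y) \<partial>lborel) = emeasure lborel B"
        by (simp add: lborel_distr_plus)
      then show "indicator A x * emeasure lborel B = (\<integral>\<^sup>+y. indicator A x * indicator B (x + y) \<partial>lborel)"
        by (simp add: nn_integral_cmult)
    qed
    also have "\<dots> = (\<integral>\<^sup>+y. (\<integral>\<^sup>+x. indicator A x * indicator B (x + y) \<partial>?M) \<partial>lborel)"
      by (rule Fubini'[symmetric]) (simp add: case_prod_unfold cong: measurable_cong_sets)
    also have "\<dots> = (\<integral>\<^sup>+y. (\<integral>\<^sup>+x. indicator A (x - y) * indicator B x \<partial>?M) \<partial>lborel)"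
    proof (rule nn_integral_cong)
      fix y
      have "(\<integral>\<^sup>+x. indicator A x * indicator B (x + y) \<partial>?M) =
          (\<integral>\<^sup>+x. indicator A x * indicator B (x + y) \<partial>distr ?M borel ((+) (- y)))"
        by (simp only: trans)
      also have "\<dots> = (\<integral>\<^sup>+x. indicator A (x - y) * indicator B x \<partial>?M)"
        by (subst nn_integral_distr) (auto simp: algebra_simps)
      finally show "(\<integral>\<^sup>+x. indicator A x * indicator B (x + y) \<partial>?M) =
          (\<integral>\<^sup>+x. indicator A (x - y) * indicator B x \<partial>?M)" .
    qed
    also have "\<dots> = (\<integral>\<^sup>+x. (\<integral>\<^sup>+y. indicator A (x - y) * indicator B x \<partial>lborel) \<partial>?M)"
      by (rule Fubini') (simp add: case_prod_unfold cong: measurable_cong_sets)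
    also have "\<dots> = (\<integral>\<^sup>+x. indicator B x * emeasure lborel A \<partial>?M)"
    proof (rule nn_integral_cong)
      fix x
      have "(\<integral>\<^sup>+y. indicator A (x - y) \<partial>lborel) = (\<integral>\<^sup>+y. indicator A y \<partial>distr lborel borel (\<lambda>y. x - y))"
        by (subst nn_integral_distr) auto
      also have "distr lborel borel (\<lambda>y. x - y) = lborel"
        using lborel_affine[of "-1" x] by (simp add: density_1)
      finally have "(\<integral>\<^sup>+y. indicator A (x - y) \<partial>lborel) = emeasure lborel A" by simp
      then show "(\<integral>\<^sup>+y. indicator A (x - y) * indicator B x \<partial>lborel) = indicator B x * emeasure lborel A"
        by (simp add: nn_integral_multc) (simp add: mult.commute)
    qed
    also have "\<dots> = emeasure ?M B * emeasure lborel A"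
      by (simp add: nn_integral_multc)
    finally show ?thesis .
  qed
  show ?thesis
  proof (rule measure_eqI)
    fix A assume "A \<in> sets ?M"
    then have "emeasure ?M A * emeasure lborel (ball (0::'a) 1) =
        emeasure lborel A * emeasure lborel (ball (0::'a) 1)"
      using key[of A "ball 0 1"] ball[of 1] by (simp add: mult.commute)
    moreover have "emeasure lborel (ball (0::'a) 1) \<noteq> 0"
      using emeasure_lborel_ball_finite[of "0::'a" 1] content_ball_pos[of 1 "0::'a"]
      by (auto simp: measure_def)
    moreover have "emeasure lborel (ball (0::'a) 1) \<noteq> \<infinity>"
      using emeasure_lborel_ball_finite[of "0::'a" 1] by simp
    ultimately show "emeasure ?M A = emeasure lborel A"
      by (metis ennreal_mult_divide_eq infinity_ennreal_def)
  qed simp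
qed

lemma prod_Basis_vec: "(\<Prod>b\<in>Basis. g b) = (\<Prod>i\<in>UNIV. g (axis i (1::real) :: real^'n))"
proof -
  have B: "Basis = range (\<lambda>i. axis i (1::real) :: real^'n)"
    by (auto simp: Basis_vec_def)
  show ?thesis unfolding B
    by (subst prod.reindex) (auto simp: inj_on_def axis_eq_axis)
qed

text \<open>The diagonal map scales each coordinate separately and contributes the factor; the
  orthogonal map and the translation by \<open>m\<close> preserve \<open>lborel\<close>.\<close>

lemma lborel_affine_matrix:
  fixes Q :: "real^'n^'n"
  assumes Q: "orthogonal_matrix Q" and d: "\<And>i. d i > 0"
  shows "lborel = density (distr lborel borel (\<lambda>u. m + (Q ** diagonal_matrix d) *v u))
    (\<lambda>_. ennreal (\<Prod>i\<in>UNIV. d i))"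
proof -
  \<comment> \<open>The scaling factors and integrals over a Euclidean space are indexed by basis
    vectors; \<open>axis_index\<close> carries the coordinate index over to them.\<close>
  define c where "c b = d (axis_index b)" for b :: "real^'n"
  have c: "c (axis i 1) = d i" for i by (simp add: c_def axis_index_axis)
  have T: "0 + (\<Sum>j\<in>Basis. (c j * (x \<bullet> j)) *\<^sub>R j) = diagonal_matrix d *v x" for x
  proof -
    have "(\<Sum>j\<in>Basis. (c j * (x \<bullet> j)) *\<^sub>R j) \<bullet> axis i 1 = c (axis i 1) * (x \<bullet> axis i 1)" for i
      by (subst inner_sum_left_Basis) auto
    then show ?thesis
      by (simp add: vec_eq_iff inner_axis c diagonal_matrix_def matrix_vector_mult_def if_distrib
          if_distribR cong: if_cong)
  qed
  let ?R = "\<lambda>u. m + Q *v u"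
  have [measurable]: "(\<lambda>x. M *v x) \<in> borel_measurable borel" for M :: "real^'n^'n"
    by (intro borel_measurable_continuous_onI linear_continuous_on matrix_vector_mul_bounded_linear)
  have R: "distr lborel borel ?R = lborel"
  proof -
    have "distr lborel borel ?R = distr (distr lborel borel ((*v) Q)) borel ((+) m)"
      by (subst distr_distr) (auto simp: o_def)
    also have "distr lborel borel ((*v) Q) = lborel"
      using Q by (intro distr_lborel_orthogonal_transformation) (simp add: orthogonal_transformation_matrix)
    finally show ?thesis by (simp add: lborel_distr_plus)
  qed
  have prod: "(\<Prod>j\<in>Basis. \<bar>c j\<bar>) = (\<Prod>i\<in>UNIV. d i)"
    using d by (simp add: prod_Basis_vec c abs_of_pos)
  have cne: "c j \<noteq> 0" for j using d[of "axis_index j"] by (simp add: c_def)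
  have "lborel = density (distr lborel borel ((*v) (diagonal_matrix d))) (\<lambda>_. ennreal (\<Prod>i\<in>UNIV. d i))"
    using lborel_affine_euclidean[of c 0, OF cne] unfolding T prod by simp
  then have "distr lborel borel ?R =
      distr (density (distr lborel borel ((*v) (diagonal_matrix d))) (\<lambda>_. ennreal (\<Prod>i\<in>UNIV. d i))) borel ?R"
    by simp
  also have "\<dots> = density (distr (distr lborel borel ((*v) (diagonal_matrix d))) borel ?R) (\<lambda>_. ennreal (\<Prod>i\<in>UNIV. d i))"
    by (subst density_distr) auto
  also have "distr (distr lborel borel ((*v) (diagonal_matrix d))) borel ?R =
      distr lborel borel (\<lambda>u. m + (Q ** diagonal_matrix d) *v u)"
    by (subst distr_distr) (auto simp: o_def matrix_vector_mul_assoc)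
  finally show ?thesis by (simp only: R)
qed

text \<open>\<open>lborel\<close> is the image of a product of one-dimensional Lebesgue measures
  indexed by \<open>Basis\<close>, so an integrand that factorises over the coordinates is treated
  by the product form of Fubini.\<close>

lemma lborel_integral_prod:
  fixes h :: "'n::finite \<Rightarrow> real \<Rightarrow> real"
  assumes h: "\<And>i. integrable lborel (h i)"
  shows "integrable lborel (\<lambda>u::real^'n. \<Prod>i\<in>UNIV. h i (u $ i))"
    and "(\<integral>u. (\<Prod>i\<in>UNIV. h i ((u :: real^'n) $ i)) \<partial>lborel) = (\<Prod>i\<in>UNIV. \<integral>x. h i x \<partial>lborel)"
proof -
  define H where "H b = h (axis_index b)" for b :: "real^'n"
  interpret product_sigma_finite "\<lambda>_ :: real^'n. lborel :: real measure"
    by (intro product_sigma_finite.intro sigma_finite_lborel)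
  let ?S = "\<lambda>f. \<Sum>b\<in>Basis. f b *\<^sub>R (b :: real^'n)"
  have [measurable]: "h i \<in> borel_measurable borel" for i
    using borel_measurable_integrable[OF h] by simp
  have eq: "(\<Prod>i\<in>UNIV. h i (?S f $ i)) = (\<Prod>b\<in>Basis. H b (f b))" for f
  proof -
    have "?S f $ i = f (axis i 1)" for i
      using inner_sum_left_Basis[of "axis i 1 :: real^'n" f] by (simp add: inner_axis)
    then show ?thesis by (simp add: prod_Basis_vec H_def axis_index_axis)
  qed
  have int: "integrable (\<Pi>\<^sub>M b\<in>Basis. lborel) (\<lambda>f. \<Prod>b\<in>Basis. H b (f b))"
    by (rule product_integrable_prod) (auto simp: H_def h)
  show "integrable lborel (\<lambda>u::real^'n. \<Prod>i\<in>UNIV. h i (u $ i))"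
    unfolding lborel_eq[where 'a = "real^'n"] by (subst integrable_distr_eq, simp_all only: eq int, measurable)
  have "(\<integral>u. (\<Prod>i\<in>UNIV. h i ((u :: real^'n) $ i)) \<partial>lborel) = (\<integral>f. (\<Prod>b\<in>Basis. H b (f b)) \<partial>(\<Pi>\<^sub>M b\<in>Basis. lborel))"
    unfolding lborel_eq[where 'a = "real^'n"] by (subst integral_distr, simp_all only: eq, measurable)
  also have "\<dots> = (\<Prod>b\<in>Basis. \<integral>x. H b x \<partial>lborel)"
    by (rule product_integral_prod) (auto simp: H_def h)
  finally show "(\<integral>u. (\<Prod>i\<in>UNIV. h i ((u :: real^'n) $ i)) \<partial>lborel) = (\<Prod>i\<in>UNIV. \<integral>x. h i x \<partial>lborel)"
    by (simp add: prod_Basis_vec H_def axis_index_axis)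
qed

section \<open>The standard Gaussian measure and its affine images\<close>

text \<open>Written as a product of one-dimensional densities so that every moment factorises over
  the coordinates.\<close>

definition std_gaussian :: "(real^'n) measure" where
  "std_gaussian = density lborel (\<lambda>u. ennreal (\<Prod>i\<in>UNIV. std_normal_density (u $ i)))"

lemma sets_std_gaussian [simp, measurable_cong]: "sets std_gaussian = sets borel"
  by (simp add: std_gaussian_def)

lemma space_std_gaussian [simp]: "space std_gaussian = UNIV"
  by (simp add: std_gaussian_def)

lemma std_normal_has_bochner_integral:
  "has_bochner_integral lborel std_normal_density 1"
  "has_bochner_integral lborel (\<lambda>x. std_normal_density x * x) 0"
  "has_bochner_integral lborel (\<lambda>x. std_normal_density x * (x * x)) 1"
  using std_normal_moment_even[of 0] std_normal_moment_odd[of 0] std_normal_moment_even[of 1]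
  by (simp_all add: power2_eq_square)

text \<open>Source of the total mass and of the first and second moments: each \<open>g i\<close> is
  taken to be a product of factors \<open>1\<close> and \<open>x\<close>.\<close>

lemma std_gaussian_has_bochner_integral_prod:
  fixes g :: "'n::finite \<Rightarrow> real \<Rightarrow> real"
  assumes "\<And>i. has_bochner_integral lborel (\<lambda>x. std_normal_density x * g i x) (v i)"
    and [measurable]: "\<And>i. g i \<in> borel_measurable borel"
  shows "has_bochner_integral std_gaussian (\<lambda>u. \<Prod>i\<in>UNIV. g i (u $ i)) (\<Prod>i\<in>UNIV. v i)"
proof -
  have int: "integrable lborel (\<lambda>x. std_normal_density x * g i x)"
    "(\<integral>x. std_normal_density x * g i x \<partial>lborel) = v i" for i
    using assms(1)[of i] by (auto simp: has_bochner_integral_iff)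
  have eq: "(\<Prod>i\<in>UNIV. std_normal_density (u $ i)) * (\<Prod>i\<in>UNIV. g i (u $ i)) =
      (\<Prod>i\<in>UNIV. std_normal_density (u $ i) * g i (u $ i))" for u :: "real^'n"
    by (simp add: prod.distrib)
  have nonneg: "0 \<le> (\<Prod>i\<in>UNIV. std_normal_density (u $ i))" for u :: "real^'n"
    by (simp add: prod_nonneg)
  have "integrable std_gaussian (\<lambda>u :: real^'n. \<Prod>i\<in>UNIV. g i (u $ i))"
    unfolding std_gaussian_def
    by (subst integrable_density) (auto simp: nonneg eq intro!: lborel_integral_prod int)
  moreover have "(\<integral>u. (\<Prod>i\<in>UNIV. g i (u $ i)) \<partial>std_gaussian) = (\<Prod>i\<in>UNIV. v i)"
    unfolding std_gaussian_def
    by (subst integral_density) (auto simp: nonneg eq lborel_integral_prod(2)[OF int(1)] int(2))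
  ultimately show ?thesis by (simp add: has_bochner_integral_iff)
qed

lemma prob_space_std_gaussian: "prob_space (std_gaussian :: (real^'n) measure)"
proof
  have "has_bochner_integral (std_gaussian :: (real^'n) measure) (\<lambda>u. 1 :: real) 1"
    using std_gaussian_has_bochner_integral_prod[where 'n = 'n, of "\<lambda>_ _. 1" "\<lambda>_. 1"] std_normal_has_bochner_integral(1)
    by simp
  then have "(\<integral>u. 1 \<partial>(std_gaussian :: (real^'n) measure)) = (1::real)"
    by (rule has_bochner_integral_integral_eq)
  then have 1: "measure (std_gaussian :: (real^'n) measure) UNIV = 1"
    by simp
  \<comment> \<open>\<open>measure\<close> sends infinite mass to 0, so the value 1 rules out
    infinite mass.\<close>
  then have "emeasure (std_gaussian :: (real^'n) measure) UNIV \<noteq> top"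
    by (metis measure_def enn2real_top zero_neq_one)
  then show "emeasure (std_gaussian :: (real^'n) measure) (space std_gaussian) = 1"
    by (subst emeasure_eq_ennreal_measure) (simp_all add: 1)
qed

lemma prod_if_eq: "(\<Prod>i\<in>UNIV. if i = k then a i else 1) = (a k :: real)" for k :: "'n::finite"
  by (simp add: prod.delta)

lemma std_gaussian_moment1: "has_bochner_integral std_gaussian (\<lambda>u. u $ k) 0"
proof -
  have "has_bochner_integral std_gaussian (\<lambda>u. \<Prod>i\<in>UNIV. (\<lambda>x. if i = k then x else 1) (u $ i))
      (\<Prod>i\<in>UNIV. if i = k then 0 else 1)"
    by (rule std_gaussian_has_bochner_integral_prod) (auto simp: std_normal_has_bochner_integral)
  then show ?thesis by (simp add: prod_if_eq)
qed

lemma std_gaussian_moment2: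
  "has_bochner_integral std_gaussian (\<lambda>u. u $ k * u $ l) (if k = l then 1 else 0)"
proof -
  let ?g = "\<lambda>i x. (if i = k then x else 1) * (if i = l then x else (1::real))"
  \<comment> \<open>For \<open>k = l\<close> the factor at \<open>k\<close> is a second moment,
    equal to 1. Otherwise the factors at \<open>k\<close> and \<open>l\<close> are first moments,
    equal to 0.\<close>
  let ?v = "\<lambda>i. if k = l then 1 else if i = k then 0 else if i = l then 0 else (1::real)"
  have "has_bochner_integral std_gaussian (\<lambda>u. \<Prod>i\<in>UNIV. ?g i (u $ i)) (\<Prod>i\<in>UNIV. ?v i)"
    by (rule std_gaussian_has_bochner_integral_prod) (auto simp: std_normal_has_bochner_integral)
  moreover have "(\<Prod>i\<in>UNIV. ?g i (u $ i)) = u $ k * u $ l" for u :: "real^'a"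
    by (simp add: prod.distrib prod_if_eq)
  moreover have "(\<Prod>i\<in>UNIV. ?v i) = (if k = l then 1 else 0)"
    by auto
  ultimately show ?thesis by simp
qed

text \<open>The standard coordinates are centred with identity covariance, so only the diagonal
  terms of the expanded product survive. \<open>L\<close> may be rectangular, which lets the same
  statement serve projections of a Gaussian.\<close>

lemma affine_std_gaussian:
  fixes a :: "real^'n" and L :: "real^'k^'n"
  defines "M \<equiv> distr std_gaussian borel (\<lambda>u. a + L *v u)"
  shows "integrable M (\<lambda>x. (norm x)\<^sup>2)" and "covariance_matrix M = L ** transpose L"
proof -
  interpret prob_space "std_gaussian :: (real^'k) measure" by (rule prob_space_std_gaussian)
  have [measurable]: "(\<lambda>u. L *v u) \<in> borel_measurable borel"
    by (intro borel_measurable_continuous_onI linear_continuous_on matrix_vector_mul_bounded_linear)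
  have c1: "integrable std_gaussian (\<lambda>u :: real^'k. u $ k)" "(\<integral>u. u $ k \<partial>std_gaussian) = 0" for k :: 'k
    using std_gaussian_moment1[of k] by (auto simp: has_bochner_integral_iff)
  have c2: "integrable std_gaussian (\<lambda>u :: real^'k. u $ k * u $ l)"
    "(\<integral>u. u $ k * u $ l \<partial>std_gaussian) = (if k = l then 1 else 0)" for k l :: 'k
    using std_gaussian_moment2[of k l] by (auto simp: has_bochner_integral_iff)
  have Lc: "(L *v u) $ i = (\<Sum>k\<in>UNIV. L $ i $ k * u $ k)" for u i
    by (simp add: matrix_vector_mult_def)
  have LL: "(L *v u) $ i * (L *v u) $ j = (\<Sum>k\<in>UNIV. \<Sum>l\<in>UNIV. (L $ i $ k * L $ j $ l) * (u $ k * u $ l))" for u i j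
    unfolding Lc sum_product by (intro sum.cong refl) (simp add: mult_ac)
  have intLL: "integrable std_gaussian (\<lambda>u. (L *v u) $ i * (L *v u) $ j)" for i j
    unfolding LL by (intro Bochner_Integration.integrable_sum integrable_mult_right) (rule c2)
  \<comment> \<open>Vector-valued integrability of the identity is assembled from its coordinates by
    expanding \<open>u\<close> in the standard basis.\<close>
  have "integrable std_gaussian (\<lambda>u :: real^'k. \<Sum>k\<in>UNIV. u $ k *\<^sub>R axis k (1::real))"
    by (intro Bochner_Integration.integrable_sum integrable_scaleR_left c1)
  moreover have "(\<Sum>k\<in>UNIV. u $ k *\<^sub>R axis k (1::real)) = u" for u :: "real^'k"
    by (simp add: vec_eq_iff axis_def if_distrib cong: if_cong)
  ultimately have int: "integrable std_gaussian (\<lambda>u :: real^'k. u)" by simp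
  have "(\<integral>u. u \<partial>(std_gaussian :: (real^'k) measure)) $ k = 0" for k
    using integral_bounded_linear[OF bounded_linear_vec_nth int, of k] c1(2)[of k] by simp
  then have mean0: "(\<integral>u. u \<partial>(std_gaussian :: (real^'k) measure)) = 0"
    by (simp add: vec_eq_iff)
  have intL: "integrable std_gaussian (\<lambda>u. L *v u)"
    by (rule integrable_bounded_linear[OF matrix_vector_mul_bounded_linear int])
  have meanL: "(\<integral>u. L *v u \<partial>std_gaussian) = 0"
    using integral_bounded_linear[OF matrix_vector_mul_bounded_linear int, of L] mean0 by simp
  have "(\<integral>x. x \<partial>M) = (\<integral>u. a + L *v u \<partial>std_gaussian)"
    unfolding M_def by (subst integral_distr) auto
  also have "\<dots> = a"
    using intL by (subst Bochner_Integration.integral_add) (auto simp: meanL prob_space[simplified])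
  finally have mean: "(\<integral>x. x \<partial>M) = a" .
  have "covariance_matrix M $ i $ j = (L ** transpose L) $ i $ j" for i j
  proof -
    have "covariance_matrix M $ i $ j = (\<integral>x. (x - a) $ i * (x - a) $ j \<partial>M)"
      by (simp add: covariance_matrix_def mean)
    also have "\<dots> = (\<integral>u. (L *v u) $ i * (L *v u) $ j \<partial>std_gaussian)"
      unfolding M_def by (subst integral_distr) auto
    also have "\<dots> = (\<Sum>k\<in>UNIV. \<Sum>l\<in>UNIV. (L $ i $ k * L $ j $ l) * (if k = l then 1 else 0))"
      unfolding LL by (simp add: Bochner_Integration.integral_sum c2)
    also have "\<dots> = (\<Sum>k\<in>UNIV. \<Sum>l\<in>UNIV. if k = l then L $ i $ k * L $ j $ l else 0)"
      by (intro sum.cong refl) simp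
    also have "\<dots> = (L ** transpose L) $ i $ j"
      by (simp add: matrix_matrix_mult_def transpose_def)
    finally show ?thesis .
  qed
  then show "covariance_matrix M = L ** transpose L" by (simp add: vec_eq_iff)
  have intLc: "integrable std_gaussian (\<lambda>u. (L *v u) $ i)" for i
    by (rule integrable_bounded_linear[OF bounded_linear_vec_nth intL])
  have "integrable std_gaussian
      (\<lambda>u. \<Sum>i\<in>UNIV. a $ i * a $ i + 2 * a $ i * (L *v u) $ i + (L *v u) $ i * (L *v u) $ i)"
    by (rule Bochner_Integration.integrable_sum, rule Bochner_Integration.integrable_add,
        rule Bochner_Integration.integrable_add, rule integrable_const,
        rule integrable_mult_right, rule intLc, rule intLL)
  moreover have "(norm (a + L *v u))\<^sup>2 =
      (\<Sum>i\<in>UNIV. a $ i * a $ i + 2 * a $ i * (L *v u) $ i + (L *v u) $ i * (L *v u) $ i)" for u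
    unfolding power2_norm_eq_inner inner_vec_def by (simp add: algebra_simps)
  ultimately have "integrable std_gaussian (\<lambda>u. (norm (a + L *v u))\<^sup>2)"
    by (simp only:)
  then show "integrable M (\<lambda>x. (norm x)\<^sup>2)"
    unfolding M_def by (subst integrable_distr_eq) auto
qed

text \<open>With \<open>P\<close> a square root of \<open>C\<close>, the substitution
  \<open>z = m + P *v u\<close> turns the exponent into the standard one. Its Jacobian \<delta> is
  the square root of \<open>det C\<close> and cancels the normalising power of the
  determinant.\<close>

lemma gaussian_density_pushforward:
  fixes C :: "real^('n::finite + 'n)^('n + 'n)"
  assumes C: "sym_pos_def C"
  shows "\<exists>P :: real^('n + 'n)^('n + 'n). P ** transpose P = C \<and>
    density lborel (\<lambda>z. ennreal (gaussian_density m C z)) = distr std_gaussian borel (\<lambda>u. m + P *v u)"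
proof -
  obtain Q and d :: "'n + 'n \<Rightarrow> real" where Q: "orthogonal_matrix Q" and d: "\<forall>i. d i > 0"
    and CQ: "C = (Q ** diagonal_matrix d) ** transpose (Q ** diagonal_matrix d)"
    and det': "det C = (\<Prod>i\<in>UNIV. d i)\<^sup>2"
    using sym_pos_def_square_root[OF C] by (elim exE conjE)
  define P where "P = Q ** diagonal_matrix d"
  have CP: "C = P ** transpose P" by (simp only: CQ P_def)
  define \<delta> where "\<delta> = (\<Prod>i\<in>UNIV. d i)"
  have dpos: "\<delta> > 0" using d by (simp add: \<delta>_def prod_pos)
  have det: "det C = \<delta>\<^sup>2" by (simp only: det' \<delta>_def)
  let ?T = "\<lambda>u. m + P *v u"
  let ?G = "gaussian_density m C"
  have [measurable]: "(\<lambda>x. M *v x) \<in> borel_measurable borel" for M :: "real^('n + 'n)^('n + 'n)"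
    by (intro borel_measurable_continuous_onI linear_continuous_on matrix_vector_mul_bounded_linear)
  have [measurable]: "?G \<in> borel_measurable borel"
    unfolding gaussian_density_def[abs_def] weighted_norm_sq_def by measurable
  have "\<delta> * ?G (?T u) = (\<Prod>i\<in>UNIV. std_normal_density (u $ i))" for u
  proof -
    have "det C > 0" unfolding det using dpos by (rule zero_less_power)
    then have "det (P ** transpose P) \<noteq> 0" by (simp only: CP)
    then have "weighted_norm_sq C (?T u - m) = u \<bullet> u"
      using weighted_norm_sq_square_root[of P u] by (simp add: CP)
    moreover have "det C powr (-1/2) = 1 / \<delta>"
      using dpos by (simp add: det powr_minus powr_half_sqrt field_simps)
    ultimately have "\<delta> * ?G (?T u) = 1 / (2 * pi) ^ CARD('n) * exp (- (u \<bullet> u) / 2)"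
      using dpos by (simp add: gaussian_density_def)
    also have "\<dots> = (\<Prod>i\<in>UNIV. std_normal_density (u $ i))"
    proof -
      have "(\<Prod>i\<in>UNIV. std_normal_density (u $ i)) =
          (1 / sqrt (2 * pi)) ^ (CARD('n) + CARD('n)) * exp (\<Sum>i\<in>UNIV. - (u $ i)\<^sup>2 / 2)"
        by (simp only: std_normal_density_def prod.distrib exp_sum finite) (simp add: power_add)
      \<comment> \<open>The index type has twice \<open>CARD('n)\<close> elements, so the factors
        pair up and the square roots disappear.\<close>
      also have "(1 / sqrt (2 * pi)) ^ (CARD('n) + CARD('n)) = ((1 / sqrt (2 * pi)) * (1 / sqrt (2 * pi))) ^ CARD('n)"
        by (simp only: power_add power_mult_distrib)
      also have "\<dots> = 1 / (2 * pi) ^ CARD('n)"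
        by (simp add: power_divide)
      also have "(\<Sum>i\<in>UNIV. - (u $ i)\<^sup>2 / 2) = - (u \<bullet> u) / 2"
        by (simp add: inner_vec_def power2_eq_square sum_negf flip: sum_divide_distrib)
      finally show ?thesis by simp
    qed
    finally show ?thesis .
  qed
  then have eq: "ennreal \<delta> * ennreal (?G (?T u)) = ennreal (\<Prod>i\<in>UNIV. std_normal_density (u $ i))" for u
    using dpos by (metis ennreal_mult' less_imp_le)
  have "density lborel ?G = density (density (distr lborel borel ?T) (\<lambda>_. ennreal \<delta>)) ?G"
    unfolding P_def \<delta>_def using lborel_affine_matrix[OF Q d[rule_format], of m] by simp
  also have "\<dots> = density (distr lborel borel ?T) (\<lambda>z. ennreal \<delta> * ennreal (?G z))"
    by (subst density_density_eq) auto
  also have "\<dots> = distr (density lborel (\<lambda>u. ennreal \<delta> * ennreal (?G (?T u)))) borel ?T"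
    by (subst density_distr) auto
  also have "\<dots> = distr std_gaussian borel ?T"
    by (simp only: eq std_gaussian_def)
  finally have G: "density lborel ?G = distr std_gaussian borel ?T" .
  show ?thesis by (rule exI[of _ P], rule conjI, rule CP[symmetric], rule G)
qed

section \<open>Derivatives of determinants, inverses and Gaussian densities\<close>

lemma bounded_bilinear_matrix_matrix_mult:
  "bounded_bilinear ((**) :: real^'n^'m \<Rightarrow> real^'k^'n \<Rightarrow> real^'k^'m)"
  unfolding bilinear_conv_bounded_bilinear[symmetric] bilinear_def linear_iff
  by (auto simp: matrix_matrix_mult_def vec_eq_iff algebra_simps sum.distrib sum_distrib_left)

lemma bounded_bilinear_matrix_vector_mult:
  "bounded_bilinear ((*v) :: real^'n^'m \<Rightarrow> real^'n \<Rightarrow> real^'m)"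
  unfolding bilinear_conv_bounded_bilinear[symmetric] bilinear_def linear_iff
  by (auto simp: matrix_vector_mult_def vec_eq_iff algebra_simps sum.distrib sum_distrib_left)

lemma matrix_entry_has_real_derivative:
  fixes A :: "real \<Rightarrow> real^'n^'m"
  assumes "(A has_vector_derivative A') (at t within S)"
  shows "((\<lambda>s. A s $ i $ j) has_real_derivative A' $ i $ j) (at t within S)"
  unfolding has_real_derivative_iff_has_vector_derivative
  by (intro bounded_linear.has_vector_derivative[OF bounded_linear_vec_nth] assms)

lemma matrix_has_vector_derivativeI:
  fixes A :: "real \<Rightarrow> real^'n^'m"
  assumes "\<And>i j. ((\<lambda>s. A s $ i $ j) has_real_derivative A' $ i $ j) (at t within S)"
  shows "(A has_vector_derivative A') (at t within S)"
proof -
  have eq: "M = (\<Sum>i\<in>UNIV. \<Sum>j\<in>UNIV. M $ i $ j *\<^sub>R axis i (axis j 1))" for M :: "real^'n^'m"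
  proof -
    have "(\<Sum>i\<in>UNIV. \<Sum>j\<in>UNIV. M $ i $ j *\<^sub>R (axis i (axis j 1) :: real^'n^'m)) $ k $ l =
        (\<Sum>i\<in>UNIV. if i = k then (\<Sum>j\<in>UNIV. if j = l then M $ i $ j else 0) else 0)" (is "_ = ?r k l") for k l
      unfolding sum_component vector_scaleR_component axis_def
      by (intro sum.cong refl) (auto intro!: sum.cong simp del: sum.delta sum.delta')
    moreover have "?r k l = M $ k $ l" for k l by simp
    ultimately show ?thesis by (intro vec_eq_iff[THEN iffD2] allI) (simp only:)
  qed
  have "((\<lambda>s. \<Sum>i\<in>UNIV. \<Sum>j\<in>UNIV. A s $ i $ j *\<^sub>R (axis i (axis j 1) :: real^'n^'m))
      has_vector_derivative (\<Sum>i\<in>UNIV. \<Sum>j\<in>UNIV. A' $ i $ j *\<^sub>R axis i (axis j 1))) (at t within S)"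
    using assms unfolding has_real_derivative_iff_has_vector_derivative
    by (intro has_vector_derivative_sum bounded_linear.has_vector_derivative[OF bounded_linear_scaleR_left])
  then show ?thesis by (simp only: eq[symmetric])
qed

text \<open>The Leibniz expansion differentiated termwise. The unwieldy value is evaluated only at
  the identity matrix; elsewhere it serves to show that a derivative exists.\<close>

lemma has_real_derivative_det:
  fixes A :: "real \<Rightarrow> real^'n^'n"
  assumes A: "(A has_vector_derivative A') (at t within S)"
  shows "((\<lambda>s. det (A s)) has_real_derivative
    (\<Sum>p\<in>{p. p permutes UNIV}. of_int (sign p) *
      (\<Sum>i\<in>UNIV. A' $ i $ p i * (\<Prod>j\<in>UNIV - {i}. A t $ j $ p j)))) (at t within S)"
proof -
  have "((\<lambda>s. \<Prod>i\<in>UNIV. A s $ i $ p i) has_real_derivative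
      (\<Sum>i\<in>UNIV. A' $ i $ p i * (\<Prod>j\<in>UNIV - {i}. A t $ j $ p j))) (at t within S)" for p
  proof -
    have "((\<lambda>s. A s $ i $ p i) has_derivative (\<lambda>h. A' $ i $ p i * h)) (at t within S)" for i
      using matrix_entry_has_real_derivative[OF A] by (simp add: has_field_derivative_def)
    then have "((\<lambda>s. \<Prod>i\<in>UNIV. A s $ i $ p i) has_derivative
        (\<lambda>h. \<Sum>i\<in>UNIV. A' $ i $ p i * h * (\<Prod>j\<in>UNIV - {i}. A t $ j $ p j))) (at t within S)"
      by (intro has_derivative_prod)
    moreover have "(\<lambda>h. \<Sum>i\<in>UNIV. A' $ i $ p i * h * (\<Prod>j\<in>UNIV - {i}. A t $ j $ p j)) =
        (*) (\<Sum>i\<in>UNIV. A' $ i $ p i * (\<Prod>j\<in>UNIV - {i}. A t $ j $ p j))"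
      by (rule ext) (simp add: sum_distrib_left mult_ac)
    ultimately show ?thesis by (simp only: has_field_derivative_def)
  qed
  then show ?thesis
    unfolding det_def by (intro DERIV_sum DERIV_cmult)
qed

text \<open>A permutation other than \<open>id\<close> moves a point \<open>k\<close> and also
  \<open>p k\<close>. Deleting one factor from its product leaves an off-diagonal zero of the
  identity matrix, so only \<open>id\<close> contributes.\<close>

lemma has_real_derivative_det_at_identity:
  fixes A :: "real \<Rightarrow> real^'n^'n"
  assumes A: "(A has_vector_derivative A') (at t within S)" and At: "A t = mat 1"
  shows "((\<lambda>s. det (A s)) has_real_derivative trace A') (at t within S)"
proof -
  let ?g = "\<lambda>p. of_int (sign p) * (\<Sum>i\<in>UNIV. A' $ i $ p i * (\<Prod>j\<in>UNIV - {i}. (mat 1 :: real^'n^'n) $ j $ p j))"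
  have zero: "?g p = 0" if p: "p permutes UNIV" and "p \<noteq> id" for p
  proof -
    obtain k where k: "p k \<noteq> k" using \<open>p \<noteq> id\<close> by fastforce
    then have pk: "p (p k) \<noteq> p k" using permutes_inj[OF p] by (auto dest: injD)
    have "(\<Prod>j\<in>UNIV - {i}. (mat 1 :: real^'n^'n) $ j $ p j) = 0" for i
    proof (rule prod_zero)
      have "(if i = k then p k else k) \<in> UNIV - {i}" using k by auto
      moreover have "(mat 1 :: real^'n^'n) $ (if i = k then p k else k) $ p (if i = k then p k else k) = 0"
        using k pk by (simp add: mat_def)
      ultimately show "\<exists>j\<in>UNIV - {i}. (mat 1 :: real^'n^'n) $ j $ p j = 0" by blast
    qed simp
    then show ?thesis by (simp only: mult_zero_right sum.neutral_const)
  qed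
  have "(\<Sum>p\<in>{p. p permutes UNIV}. ?g p) = (\<Sum>p\<in>{id}. ?g p)"
    using zero by (intro sum.mono_neutral_right) (auto simp: permutes_id)
  also have "\<dots> = trace A'"
    by (simp add: trace_def mat_def sign_id)
  finally show ?thesis
    using has_real_derivative_det[OF A] by (simp add: At)
qed

text \<open>Multiplying by the constant matrix \<open>matrix_inv (A t)\<close> moves the base point
  to the identity.\<close>

lemma jacobi_formula:
  fixes A :: "real \<Rightarrow> real^'n^'n"
  assumes A: "(A has_vector_derivative A') (at t within S)" and det: "det (A t) \<noteq> 0"
  shows "((\<lambda>s. det (A s)) has_real_derivative det (A t) * trace (matrix_inv (A t) ** A')) (at t within S)"
proof -
  have "((\<lambda>s. matrix_inv (A t) ** A s) has_vector_derivative matrix_inv (A t) ** A') (at t within S)"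
    by (rule bounded_linear.has_vector_derivative[OF bounded_bilinear.bounded_linear_right[OF bounded_bilinear_matrix_matrix_mult] A])
  then have "((\<lambda>s. det (matrix_inv (A t) ** A s)) has_real_derivative trace (matrix_inv (A t) ** A')) (at t within S)"
    by (rule has_real_derivative_det_at_identity) (rule matrix_inv_mult[OF det])
  then have "((\<lambda>s. det (A t) * det (matrix_inv (A t) ** A s)) has_real_derivative
      det (A t) * trace (matrix_inv (A t) ** A')) (at t within S)"
    by (rule DERIV_cmult)
  moreover have "det (A t) * det (matrix_inv (A t) ** A s) = det (A s)" for s
    by (simp add: matrix_mul_assoc matrix_inv_mult[OF det] flip: det_mul)
  ultimately show ?thesis by simp
qed

text \<open>Cramer's rule; as quotients of determinants the entries of the inverse are visibly
  differentiable along a curve.\<close>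

lemma matrix_inv_entry:
  fixes A :: "real^'n^'n"
  assumes "det A \<noteq> 0"
  shows "matrix_inv A $ k $ l = det (\<chi> i j. if j = k then axis l 1 $ i else A $ i $ j) / det A"
proof -
  have "matrix_inv A *v axis l 1 = (\<chi> k. det (\<chi> i j. if j = k then axis l 1 $ i else A $ i $ j) / det A)"
    using cramer[OF assms, of "matrix_inv A *v axis l 1" "axis l 1"] matrix_inv_mult_vector(1)[OF assms]
    by blast
  then show ?thesis
    by (simp add: matrix_vector_mult_basis column_def vec_eq_iff)
qed

text \<open>Cramer's rule gives existence of the derivative; its value then follows by
  differentiating \<open>A s ** matrix_inv (A s) = mat 1\<close>.\<close>

lemma has_vector_derivative_matrix_inv:
  fixes A :: "real \<Rightarrow> real^'n^'n"
  assumes A: "(A has_vector_derivative A') (at t within S)"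
    and det: "\<And>s. s \<in> S \<Longrightarrow> det (A s) \<noteq> 0" and t: "t \<in> S"
  shows "((\<lambda>s. matrix_inv (A s)) has_vector_derivative
    - (matrix_inv (A t) ** A' ** matrix_inv (A t))) (at t within S)"
\<comment> \<open>At an isolated point of \<open>S\<close>, as for the time interval
  \<open>{0}\<close>, derivatives are not unique and any value qualifies; uniqueness is used in the
  other case.\<close>
proof (cases "at t within S = bot")
  case True
  then show ?thesis
    unfolding has_vector_derivative_def has_derivative_def
    by (intro conjI bounded_linear_scaleR_left) simp
next
  case False
  have "\<exists>D. ((\<lambda>s. matrix_inv (A s) $ k $ l) has_real_derivative D) (at t within S)" for k l
  proof -
    let ?B = "\<lambda>s. (\<chi> i j. if j = k then axis l 1 $ i else A s $ i $ j) :: real^'n^'n"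
    have "(?B has_vector_derivative (\<chi> i j. if j = k then 0 else A' $ i $ j)) (at t within S)"
      by (rule matrix_has_vector_derivativeI) (auto intro: matrix_entry_has_real_derivative[OF A])
    from DERIV_divide[OF has_real_derivative_det[OF this] has_real_derivative_det[OF A] det[OF t]]
    obtain D where "((\<lambda>s. det (?B s) / det (A s)) has_real_derivative D) (at t within S)"
      by blast
    then have "((\<lambda>s. matrix_inv (A s) $ k $ l) has_real_derivative D) (at t within S)"
      by (rule has_field_derivative_transform_within[OF _ zero_less_one t]) (simp add: matrix_inv_entry det)
    then show ?thesis by blast
  qed
  then obtain D where D: "\<And>k l. ((\<lambda>s. matrix_inv (A s) $ k $ l) has_real_derivative D k l) (at t within S)"
    by metis
  define N' where "N' = (\<chi> k l. D k l)"
  have N': "((\<lambda>s. matrix_inv (A s)) has_vector_derivative N') (at t within S)"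
    by (rule matrix_has_vector_derivativeI) (simp add: N'_def D)
  have "((\<lambda>s. A s ** matrix_inv (A s)) has_vector_derivative
      A t ** N' + A' ** matrix_inv (A t)) (at t within S)"
    by (rule bounded_bilinear.has_vector_derivative[OF bounded_bilinear_matrix_matrix_mult A N'])
  moreover have "((\<lambda>s. A s ** matrix_inv (A s)) has_vector_derivative 0) (at t within S)"
    by (rule has_vector_derivative_transform_within[OF has_vector_derivative_const[of "mat 1"] zero_less_one t])
      (simp add: matrix_inv_mult det)
  ultimately have "A t ** N' + A' ** matrix_inv (A t) = 0"
    by (rule vector_derivative_unique_within[OF False])
  then have "A t ** N' = - (A' ** matrix_inv (A t))" by (simp add: eq_neg_iff_add_eq_0)
  then have "matrix_inv (A t) ** (A t ** N') = - (matrix_inv (A t) ** (A' ** matrix_inv (A t)))"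
    by (simp add: bounded_bilinear.minus_right[OF bounded_bilinear_matrix_matrix_mult])
  then have "N' = - (matrix_inv (A t) ** A' ** matrix_inv (A t))"
    by (simp add: matrix_mul_assoc matrix_inv_mult[OF det[OF t]])
  with N' show ?thesis by simp
qed

section \<open>Gaussian profiles in space and time\<close>

lemma trace_transpose: "trace (transpose A) = trace A"
  by (simp add: trace_def transpose_def)

lemma grad_eqI:
  assumes "(f has_derivative (\<lambda>h. g \<bullet> h)) (at z)"
  shows "grad f z = g"
  using frechet_derivative_at[OF assms, symmetric] by (simp add: grad_def vec_eq_iff inner_axis)

text \<open>The gradient of a Gaussian is the density times an affine field, so the whole
  Fokker-Planck flux has the shape treated here, and the product rule suffices.\<close>

lemma divergence_scaleR_affine:
  fixes f :: "real^'k \<Rightarrow> real" and L :: "real^'k^'k"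
  assumes f: "(f has_derivative (\<lambda>h. g \<bullet> h)) (at z)"
  shows "(\<lambda>x. f x *\<^sub>R (a + L *v x)) differentiable at z"
    and "divergence (\<lambda>x. f x *\<^sub>R (a + L *v x)) z = f z * trace L + g \<bullet> (a + L *v z)"
proof -
  have "((\<lambda>x. a + L *v x) has_derivative (\<lambda>h. L *v h)) (at z)"
    using has_derivative_add[OF has_derivative_const
        bounded_linear_imp_has_derivative[OF matrix_vector_mul_bounded_linear[of L]]] by simp
  from has_derivative_scaleR[OF f this]
  have F: "((\<lambda>x. f x *\<^sub>R (a + L *v x)) has_derivative
      (\<lambda>h. f z *\<^sub>R (L *v h) + (g \<bullet> h) *\<^sub>R (a + L *v z))) (at z)" .
  then show "(\<lambda>x. f x *\<^sub>R (a + L *v x)) differentiable at z"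
    by (rule differentiableI)
  have "jacobian (\<lambda>x. f x *\<^sub>R (a + L *v x)) (at z) $ k $ k = f z * L $ k $ k + g $ k * (a + L *v z) $ k" for k
    using frechet_derivative_at[OF F, symmetric]
    by (simp add: jacobian_def matrix_def inner_axis matrix_vector_mult_basis column_def)
  then show "divergence (\<lambda>x. f x *\<^sub>R (a + L *v x)) z = f z * trace L + g \<bullet> (a + L *v z)"
    by (simp add: divergence_def trace_def inner_vec_def sum.distrib sum_distrib_left)
qed

lemma gaussian_density_has_derivative:
  fixes C :: "real^('n::finite + 'n)^('n + 'n)"
  assumes "transpose C = C" "det C \<noteq> 0"
  shows "(gaussian_density m C has_derivative
    (\<lambda>h. (- gaussian_density m C z *\<^sub>R (matrix_inv C *v (z - m))) \<bullet> h)) (at z)"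
proof -
  let ?N = "matrix_inv C"
  have N: "transpose ?N = ?N" by (rule transpose_matrix_inv[OF assms])
  have d: "((\<lambda>x. x - m) has_derivative (\<lambda>h. h)) (at z)"
    by (auto intro!: derivative_eq_intros)
  have Nd: "((\<lambda>x. ?N *v (x - m)) has_derivative (\<lambda>h. ?N *v h)) (at z)"
    by (rule bounded_linear.has_derivative[OF matrix_vector_mul_bounded_linear d])
  have "((\<lambda>x. (x - m) \<bullet> (?N *v (x - m))) has_derivative
      (\<lambda>h. (z - m) \<bullet> (?N *v h) + h \<bullet> (?N *v (z - m)))) (at z)"
    by (rule has_derivative_inner[OF d Nd])
  moreover have "(z - m) \<bullet> (?N *v h) + h \<bullet> (?N *v (z - m)) = 2 * ((?N *v (z - m)) \<bullet> h)" for h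
    using symmetric_inner[OF N, of "z - m" h] inner_commute[of h "?N *v (z - m)"] by simp
  ultimately have "((\<lambda>x. weighted_norm_sq C (x - m)) has_derivative
      (\<lambda>h. 2 * ((?N *v (z - m)) \<bullet> h))) (at z)"
    by (simp only: weighted_norm_sq_def)
  then have "((\<lambda>x. - 1 / 2 * weighted_norm_sq C (x - m)) has_derivative
      (\<lambda>h. - 1 / 2 * (2 * ((?N *v (z - m)) \<bullet> h)))) (at z)"
    by (rule has_derivative_mult_right)
  then have "((\<lambda>x. exp (- 1 / 2 * weighted_norm_sq C (x - m))) has_derivative
      (\<lambda>h. exp (- 1 / 2 * weighted_norm_sq C (z - m)) * (- 1 / 2 * (2 * ((?N *v (z - m)) \<bullet> h))))) (at z)"
    by (rule DERIV_exp[THEN DERIV_compose_FDERIV, THEN has_derivative_eq_rhs]) (simp add: mult.commute)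
  from has_derivative_mult_right[OF this, of "1 / (2 * pi) ^ CARD('n) * det C powr (-1/2)"]
  show ?thesis
    by (simp add: gaussian_density_def[abs_def] mult_ac)
qed

text \<open>The terms in \<open>w\<close> come from the exponent, where the minus signs of the
  exponent and of the derivative of the inverse cancel; the trace comes from the normalising factor
  through Jacobi's formula.\<close>

lemma gaussian_density_has_time_derivative:
  fixes C :: "real \<Rightarrow> real^('n::finite + 'n)^('n + 'n)" and z :: "real^('n + 'n)"
  assumes m: "(m has_vector_derivative m') (at t within S)"
    and C: "(C has_vector_derivative C') (at t within S)"
    and det: "\<And>s. s \<in> S \<Longrightarrow> det (C s) > 0" and sym: "transpose (C t) = C t" and t: "t \<in> S"
  defines "w \<equiv> matrix_inv (C t) *v (z - m t)"
  shows "((\<lambda>s. gaussian_density (m s) (C s) z) has_real_derivative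
    gaussian_density (m t) (C t) z *
      (w \<bullet> m' + (w \<bullet> (C' *v w)) / 2 - trace (matrix_inv (C t) ** C') / 2)) (at t within S)"
proof -
  let ?N = "\<lambda>s. matrix_inv (C s)"
  let ?v = "\<lambda>s. z - m s"
  have detne: "det (C s) \<noteq> 0" if "s \<in> S" for s using det[OF that] by simp
  have N: "transpose (?N t) = ?N t" by (rule transpose_matrix_inv[OF sym detne[OF t]])
  have v: "(?v has_vector_derivative - m') (at t within S)"
    using has_vector_derivative_diff[OF has_vector_derivative_const m] by simp
  have "((\<lambda>s. ?N s *v ?v s) has_vector_derivative
      ?N t *v (- m') + (- (?N t ** C' ** ?N t)) *v ?v t) (at t within S)"
    by (rule bounded_bilinear.has_vector_derivative[OF bounded_bilinear_matrix_vector_mult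
          has_vector_derivative_matrix_inv[OF C detne t] v])
  from bounded_bilinear.has_vector_derivative[OF bounded_bilinear_inner v this]
  have "((\<lambda>s. weighted_norm_sq (C s) (?v s)) has_real_derivative
      ?v t \<bullet> (?N t *v (- m') + (- (?N t ** C' ** ?N t)) *v ?v t) + (- m') \<bullet> w) (at t within S)"
    by (simp only: has_real_derivative_iff_has_vector_derivative weighted_norm_sq_def w_def)
  also have "?v t \<bullet> (?N t *v (- m') + (- (?N t ** C' ** ?N t)) *v ?v t) + (- m') \<bullet> w =
      - 2 * (w \<bullet> m') - w \<bullet> (C' *v w)"
  proof -
    have vN: "?v t \<bullet> (?N t *v x) = w \<bullet> x" for x
      by (simp add: w_def symmetric_inner[OF N])
    have "?N t *v (- m') = - (?N t *v m')"
      by (rule bounded_bilinear.minus_right[OF bounded_bilinear_matrix_vector_mult])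
    moreover have "(- (?N t ** C' ** ?N t)) *v ?v t = - (?N t *v (C' *v w))"
      by (simp add: w_def matrix_vector_mul_assoc matrix_mul_assoc
          bounded_bilinear.minus_left[OF bounded_bilinear_matrix_vector_mult])
    ultimately show ?thesis
      by (simp add: inner_diff_right vN inner_commute)
  qed
  finally have W: "((\<lambda>s. weighted_norm_sq (C s) (?v s)) has_real_derivative
      - 2 * (w \<bullet> m') - w \<bullet> (C' *v w)) (at t within S)" .
  have E: "((\<lambda>s. exp (- 1 / 2 * weighted_norm_sq (C s) (?v s))) has_real_derivative
      exp (- 1 / 2 * weighted_norm_sq (C t) (?v t)) * (- 1 / 2 * (- 2 * (w \<bullet> m') - w \<bullet> (C' *v w)))) (at t within S)"
    by (rule DERIV_chain2[OF DERIV_exp DERIV_cmult[OF W]])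
  have P: "((\<lambda>s. det (C s) powr (- 1 / 2)) has_real_derivative
      - 1 / 2 * det (C t) powr (- 1 / 2 - 1) * (det (C t) * trace (?N t ** C'))) (at t within S)"
    by (rule DERIV_chain2[OF has_real_derivative_powr[OF det[OF t]] jacobi_formula[OF C detne[OF t]]])
  \<comment> \<open>The factor \<open>det (C t)\<close> in Jacobi's formula restores the exponent
    lowered by the power rule.\<close>
  have p: "det (C t) powr (- 1 / 2 - 1) * det (C t) = det (C t) powr (- 1 / 2)"
    using det[OF t] powr_mult_base[of "det (C t)" "- 1 / 2 - 1"] by (simp add: mult.commute)
  have "- 1 / 2 * det (C t) powr (- 1 / 2 - 1) * (det (C t) * trace (?N t ** C')) =
      - 1 / 2 * (det (C t) powr (- 1 / 2 - 1) * det (C t)) * trace (?N t ** C')"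
    by (simp only: mult_ac)
  then have P': "((\<lambda>s. det (C s) powr (- 1 / 2)) has_real_derivative
      - 1 / 2 * det (C t) powr (- 1 / 2) * trace (?N t ** C')) (at t within S)"
    using P by (simp only: p)
  from DERIV_mult[OF DERIV_cmult[OF P', of "1 / (2 * pi) ^ CARD('n)"] E]
  show ?thesis
    unfolding gaussian_density_def
    by (rule DERIV_cong) (simp add: algebra_simps add_divide_distrib diff_divide_distrib)
qed

text \<open>\<open>M\<close>, \<open>W\<close> and \<open>b\<close> are constants and the moment
  equations enter at the single time \<open>t\<close>, so time-dependent coefficients can be
  inserted with their values at \<open>t\<close>.\<close>

lemma gaussian_solves_linear_fokker_planck:
  fixes C :: "real \<Rightarrow> real^('n::finite + 'n)^('n + 'n)" and M W :: "real^('n + 'n)^('n + 'n)" and z :: "real^('n + 'n)"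
  assumes m: "(m has_vector_derivative M *v m t + b) (at t within S)"
    and C: "(C has_vector_derivative M ** C t + C t ** transpose M + (W + transpose W)) (at t within S)"
    and pd: "\<And>s. s \<in> S \<Longrightarrow> sym_pos_def (C s)" and t: "t \<in> S"
  defines "F \<equiv> \<lambda>z. gaussian_density (m t) (C t) z *\<^sub>R (- (M *v z + b)) +
    W *v grad (gaussian_density (m t) (C t)) z"
  shows "F differentiable at z"
    and "((\<lambda>s. gaussian_density (m s) (C s) z) has_real_derivative divergence F z) (at t within S)"
proof -
  let ?N = "matrix_inv (C t)" and ?\<rho> = "gaussian_density (m t) (C t)"
  have sym: "transpose (C t) = C t" using pd[OF t] by (simp add: sym_pos_def_def)
  have det: "det (C s) > 0" if "s \<in> S" for s using pd[OF that] by (rule sym_pos_def_det_pos)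
  have detne: "det (C t) \<noteq> 0" using det[OF t] by simp
  have N: "transpose ?N = ?N" by (rule transpose_matrix_inv[OF sym detne])
  have rho: "(?\<rho> has_derivative (\<lambda>h. (- ?\<rho> z *\<^sub>R (?N *v (z - m t))) \<bullet> h)) (at z)" for z
    by (rule gaussian_density_has_derivative[OF sym detne])
  \<comment> \<open>Inserting the Gaussian gradient turns the flux into the density times
    \<open>- (M *v z + b) - (W ** ?N) *v (z - m t)\<close>; these are its constant and linear
    parts.\<close>
  let ?a = "(W ** ?N) *v m t - b" and ?L = "- (M + W ** ?N)"
  have F: "F = (\<lambda>z. ?\<rho> z *\<^sub>R (?a + ?L *v z))"
  proof
    fix z
    have "F z = ?\<rho> z *\<^sub>R (- (M *v z + b)) + W *v (- ?\<rho> z *\<^sub>R (?N *v (z - m t)))"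
      by (simp only: F_def grad_eqI[OF rho])
    also have "W *v (- ?\<rho> z *\<^sub>R (?N *v (z - m t))) = ?\<rho> z *\<^sub>R (- ((W ** ?N) *v (z - m t)))"
      by (simp add: matrix_vector_mult_scaleR matrix_vector_mul_assoc flip: scaleR_minus_left)
    also have "?\<rho> z *\<^sub>R (- (M *v z + b)) + \<dots> = ?\<rho> z *\<^sub>R (?a + ?L *v z)"
      unfolding scaleR_add_right[symmetric]
      by (simp add: matrix_vector_mult_diff_distrib matrix_vector_mult_add_rdistrib
          matrix_vector_mult_diff_rdistrib bounded_bilinear.minus_left[OF bounded_bilinear_matrix_vector_mult])
    finally show "F z = ?\<rho> z *\<^sub>R (?a + ?L *v z)" .
  qed
  show "F differentiable at z"
    unfolding F by (rule divergence_scaleR_affine(1)[OF rho])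
  define v where "v = z - m t"
  define w where "w = ?N *v v"
  have Cw: "C t *v w = v" unfolding w_def by (rule matrix_inv_mult_vector(1)[OF detne])
  let ?C' = "M ** C t + C t ** transpose M + (W + transpose W)"
  have L: "?a + ?L *v z = - (M *v z + b) - W *v w"
    by (simp add: w_def v_def matrix_vector_mult_diff_distrib matrix_vector_mult_add_rdistrib
        matrix_vector_mult_diff_rdistrib matrix_vector_mul_assoc bounded_bilinear.minus_left[OF bounded_bilinear_matrix_vector_mult])
  have trL: "trace ?L = - trace M - trace (W ** ?N)"
    by (simp add: trace_def sum.distrib sum_negf sum_subtractf)
  have "divergence F z = ?\<rho> z * trace ?L + (- ?\<rho> z *\<^sub>R w) \<bullet> (?a + ?L *v z)"
    unfolding F w_def v_def by (rule divergence_scaleR_affine(2)[OF rho])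
  then have div: "divergence F z =
      ?\<rho> z * (w \<bullet> (M *v z + b) + w \<bullet> (W *v w) - trace M - trace (W ** ?N))"
    unfolding L trL by (simp add: inner_diff_right algebra_simps)
  have "w \<bullet> (?C' *v w) = w \<bullet> (M *v (C t *v w)) + (C t *v w) \<bullet> (transpose M *v w)
      + w \<bullet> (W *v w) + w \<bullet> (transpose W *v w)"
    unfolding matrix_vector_mult_add_rdistrib inner_add_right symmetric_inner[OF sym] matrix_vector_mul_assoc[symmetric]
    by simp
  also have "\<dots> = 2 * (w \<bullet> (M *v v)) + 2 * (w \<bullet> (W *v w))"
    unfolding inner_transpose Cw by (simp add: inner_commute)
  finally have quad: "w \<bullet> (?C' *v w) = 2 * (w \<bullet> (M *v v)) + 2 * (w \<bullet> (W *v w))" .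
  have "trace (?N ** ?C') = trace (?N ** (M ** C t)) + trace (?N ** (C t ** transpose M))
      + trace (?N ** W) + trace (?N ** transpose W)"
    by (simp add: matrix_add_ldistrib trace_add)
  also have "trace (?N ** (M ** C t)) = trace M"
    by (subst trace_mul_sym) (simp add: matrix_inv_mult[OF detne] flip: matrix_mul_assoc)
  also have "trace (?N ** (C t ** transpose M)) = trace M"
    by (simp add: matrix_mul_assoc matrix_inv_mult[OF detne] trace_transpose)
  also have "trace (?N ** W) = trace (W ** ?N)"
    by (rule trace_mul_sym)
  also have "trace (?N ** transpose W) = trace (W ** ?N)"
    using trace_transpose[of "W ** ?N"] by (simp only: matrix_transpose_mul N)
  finally have tr: "trace (?N ** ?C') = 2 * trace M + 2 * trace (W ** ?N)" by simp
  have "((\<lambda>s. gaussian_density (m s) (C s) z) has_real_derivative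
      ?\<rho> z * (w \<bullet> (M *v m t + b) + (w \<bullet> (?C' *v w)) / 2 - trace (?N ** ?C') / 2)) (at t within S)"
    unfolding w_def v_def by (rule gaussian_density_has_time_derivative[OF m C det sym t])
  \<comment> \<open>The drift part of the covariance equation contributes
    \<open>w \<bullet> (M *v v)\<close>, exactly what moves the drift from the mean to the point
    \<open>z = m t + v\<close>.\<close>
  moreover have "w \<bullet> (M *v m t + b) + (w \<bullet> (?C' *v w)) / 2 - trace (?N ** ?C') / 2 =
      w \<bullet> (M *v z + b) + w \<bullet> (W *v w) - trace M - trace (W ** ?N)"
    unfolding quad tr by (simp add: v_def matrix_vector_mult_diff_distrib inner_diff_right inner_add_right
        add_divide_distrib diff_divide_distrib)
  ultimately show "((\<lambda>s. gaussian_density (m s) (C s) z) has_real_derivative divergence F z) (at t within S)"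
    by (simp only: div)
qed

section \<open>Preservation of positive definiteness\<close>

text \<open>The constant is the minimum of the quadratic form on the compact unit sphere; it fixes
  the starting height of the barrier.\<close>

lemma sym_pos_def_coercive:
  fixes A :: "real^'n^'n"
  assumes "sym_pos_def A"
  shows "\<exists>c>0. \<forall>x. c * (x \<bullet> x) \<le> x \<bullet> (A *v x)"
proof -
  let ?q = "\<lambda>x. x \<bullet> (A *v x)"
  have scale: "?q (r *\<^sub>R x) = r\<^sup>2 * ?q x" for r x
    by (simp add: matrix_vector_mult_scaleR power2_eq_square)
  have "axis undefined (1::real) \<in> (sphere 0 1 :: (real^'n) set)" by simp
  then have ne: "sphere 0 1 \<noteq> ({} :: (real^'n) set)" by blast
  have "continuous_on (sphere 0 1) ?q"
    by (intro continuous_intros linear_continuous_on matrix_vector_mul_bounded_linear)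
  then obtain u where u: "norm u = 1" and min: "\<And>x. norm x = 1 \<Longrightarrow> ?q u \<le> ?q x"
    using continuous_attains_inf[OF compact_sphere ne, of ?q] by (metis mem_sphere_0)
  have "u \<noteq> 0" using u by auto
  then have "?q u > 0" using assms by (simp add: sym_pos_def_def)
  moreover have "?q u * (x \<bullet> x) \<le> ?q x" for x
  proof (cases "x = 0")
    case False
    then have "?q u \<le> ?q (x /\<^sub>R norm x)" by (intro min) simp
    also have "\<dots> = ?q x / (x \<bullet> x)"
      unfolding scale by (simp add: power2_norm_eq_inner[symmetric] divide_inverse power_inverse mult.commute)
    finally show ?thesis using False by (simp add: pos_le_divide_eq)
  qed simp
  ultimately show ?thesis by blast
qed

lemma sym_pos_defI:
  fixes A :: "real^'n^'n"
  assumes "transpose A = A" "\<And>x. norm x = 1 \<Longrightarrow> x \<bullet> (A *v x) > 0"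
  shows "sym_pos_def A"
  unfolding sym_pos_def_def
proof (intro conjI allI impI assms(1))
  fix x :: "real^'n" assume x: "x \<noteq> 0"
  have "x \<bullet> (A *v x) = (norm x)\<^sup>2 * ((x /\<^sub>R norm x) \<bullet> (A *v (x /\<^sub>R norm x)))"
    using x by (simp add: matrix_vector_mult_scaleR power2_eq_square field_simps)
  then show "x \<bullet> (A *v x) > 0"
    using x assms(2)[of "x /\<^sub>R norm x"] by simp
qed

lemma bounded_quadratic_form:
  fixes M :: "real \<Rightarrow> real^'n^'n"
  assumes "compact S" "continuous_on S M"
  shows "\<exists>K. \<forall>t\<in>S. \<forall>x. \<bar>x \<bullet> (M t *v x)\<bar> \<le> K * (x \<bullet> x)"
proof -
  obtain b where b: "\<And>t. t \<in> S \<Longrightarrow> norm (M t) \<le> b"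
    using compact_imp_bounded[OF compact_continuous_image[OF assms(2,1)]] by (auto simp: bounded_iff)
  obtain k where k: "k \<ge> 0" "\<And>(A :: real^'n^'n) x. norm (A *v x) \<le> norm A * norm x * k"
    using bounded_bilinear.nonneg_bounded[OF bounded_bilinear_matrix_vector_mult] by blast
  have "\<bar>x \<bullet> (M t *v x)\<bar> \<le> (b * k) * (x \<bullet> x)" if "t \<in> S" for t x
  proof -
    have "\<bar>x \<bullet> (M t *v x)\<bar> \<le> norm x * norm (M t *v x)" by (rule Cauchy_Schwarz_ineq2)
    also have "\<dots> \<le> norm x * (norm (M t) * norm x * k)" by (intro mult_left_mono k(2)) simp
    also have "\<dots> \<le> norm x * (b * norm x * k)"
      using b[OF that] k(1) by (intro mult_left_mono mult_right_mono) auto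
    also have "\<dots> = (b * k) * (x \<bullet> x)"
      by (simp add: power2_norm_eq_inner[symmetric] power2_eq_square)
    finally show ?thesis .
  qed
  then show ?thesis by blast
qed

text \<open>The smallest eigenvalue of \<open>C\<close> stays above \<open>\<epsilon> exp (- L t)\<close> for large \<open>L\<close>: at a first
  contact time the minimising unit vector is an eigenvector, and the differential equation forces
  the quadratic form at this vector to grow faster than the barrier. Only at the contact
  time itself is it used that \<open>W\<close> is nonnegative, and there \<open>C\<close> is positive definite.\<close>

theorem lyapunov_flow_pos_def:
  fixes C M W :: "real \<Rightarrow> real^'n^'n"
  assumes I: "is_interval I" "0 \<in> I" "I \<subseteq> {0..}"
    and C: "\<And>t. t \<in> I \<Longrightarrow> (C has_vector_derivative
      M t ** C t + C t ** transpose (M t) + (W t + transpose (W t))) (at t within I)"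
    and M: "continuous_on I M"
    and sym: "\<And>t. t \<in> I \<Longrightarrow> transpose (C t) = C t"
    and W: "\<And>t x. t \<in> I \<Longrightarrow> sym_pos_def (C t) \<Longrightarrow> 0 \<le> x \<bullet> (W t *v x)"
    and C0: "sym_pos_def (C 0)" and r: "r \<in> I"
  shows "sym_pos_def (C r)"
proof -
  have r0: "r \<ge> 0" using I(3) r by auto
  have sub: "{0..r} \<subseteq> I"
    using mem_is_interval_1_I[OF I(1,2) r] by auto
  obtain c where c: "c > 0" "\<And>x. c * (x \<bullet> x) \<le> x \<bullet> (C 0 *v x)"
    using sym_pos_def_coercive[OF C0] by blast
  obtain K where K: "\<And>t x. t \<in> {0..r} \<Longrightarrow> \<bar>x \<bullet> (M t *v x)\<bar> \<le> K * (x \<bullet> x)"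
    using bounded_quadratic_form[OF compact_Icc continuous_on_subset[OF M sub]] by blast
  \<comment> \<open>The drift can pull the form down at rate at most \<open>2 * K\<close> times the
    barrier; the extra 1 makes the final inequality strict.\<close>
  define L where "L = 2 * K + 1"
  \<comment> \<open>Half of the coercivity constant leaves a strict gap at time 0, so contact cannot
    occur there.\<close>
  define l where "l t = c / 2 * exp (- L * t)" for t
  have lpos: "l t > 0" for t using c by (simp add: l_def)
  define f where "f t x = x \<bullet> (C t *v x) - l t" for t x
  have "continuous_on I C"
    unfolding continuous_on_eq_continuous_within using C by (intro ballI has_vector_derivative_continuous)
  then have contC: "continuous_on {0..r} C" using sub by (rule continuous_on_subset)
  have cont: "continuous_on ({0..r} \<times> sphere 0 1) (\<lambda>p. f (fst p) (snd p))"
    unfolding f_def l_def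
    by (intro continuous_intros bounded_bilinear.continuous_on[OF bounded_bilinear_matrix_vector_mult]
        continuous_on_compose2[OF contC]) auto
  have "f t x > 0" if "t \<in> {0..r}" "norm x = 1" for t x
  proof (rule ccontr)
    assume neg: "\<not> f t x > 0"
    \<comment> \<open>The pairs of time and unit vector at which the barrier is violated.
      Compactness of this set gives a least such time.\<close>
    define Z where "Z = ({0..r} \<times> sphere 0 1) \<inter> (\<lambda>p. f (fst p) (snd p)) -` {..0}"
    have "closed Z"
      unfolding Z_def by (intro continuous_closed_preimage[OF cont] closed_Times) auto
    then have "compact (({0..r} \<times> sphere 0 1) \<inter> Z)"
      by (intro compact_Int_closed compact_Times compact_Icc compact_sphere)
    also have "({0..r} \<times> sphere 0 1) \<inter> Z = Z" by (auto simp: Z_def)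
    finally have "compact Z" .
    then have "compact (fst ` Z)" by (intro compact_continuous_image continuous_intros)
    moreover have "(t, x) \<in> Z" using that neg by (simp add: Z_def)
    ultimately obtain T where T: "T \<in> fst ` Z" "\<And>s. s \<in> fst ` Z \<Longrightarrow> T \<le> s"
      using compact_attains_inf[of "fst ` Z"] by blast
    then obtain u where "(T, u) \<in> Z" by auto
    then have Tr: "T \<in> {0..r}" and u: "norm u = 1" and fTu: "f T u \<le> 0"
      by (auto simp: Z_def)
    have before: "f s y > 0" if "0 \<le> s" "s < T" "norm y = 1" for s y
    proof (rule ccontr)
      assume "\<not> f s y > 0"
      then have "(s, y) \<in> Z" using that Tr by (simp add: Z_def)
      then have "T \<le> s" using T(2) by force
      with that show False by simp
    qed
    have "f 0 u > 0"
      using c(2)[of u] c(1) u by (simp add: f_def l_def norm_eq_1)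
    then have T0: "T > 0" using fTu Tr by (cases "T = 0") auto
    \<comment> \<open>Strict positivity before \<open>T\<close> passes to the limit, so at
      \<open>T\<close> the barrier is touched but not crossed.\<close>
    have nonneg: "f T y \<ge> 0" if "norm y = 1" for y
    proof (rule continuous_ge_on_closure[where f = "\<lambda>s. f s y" and S = "{0..<T}"])
      have "continuous_on {0..T} (\<lambda>s. f s y)"
        using Tr that
        by (intro continuous_on_compose2[OF cont, of _ "\<lambda>s. (s, y)", simplified] continuous_intros) auto
      then show "continuous_on (closure {0..<T}) (\<lambda>s. f s y)" using T0 by simp
      show "T \<in> closure {0..<T}" using T0 by simp
      show "f s y \<ge> 0" if "s \<in> {0..<T}" for s
        using before[of s y] that \<open>norm y = 1\<close> by simp
    qed
    have TI: "T \<in> I" using sub Tr by auto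
    define E where "E = C T - l T *\<^sub>R mat 1"
    have Ev: "E *v y = C T *v y - l T *\<^sub>R y" for y
      by (simp add: E_def matrix_vector_mult_diff_rdistrib flip: scaleR_matrix_vector_assoc)
    have Esym: "transpose E = E"
      using sym[OF TI] by (auto simp: E_def transpose_def mat_def vec_eq_iff)
    have Enn: "0 \<le> y \<bullet> (E *v y)" for y
    proof (cases "y = 0")
      case False
      have "y \<bullet> (E *v y) = (norm y)\<^sup>2 * ((y /\<^sub>R norm y) \<bullet> (E *v (y /\<^sub>R norm y)))"
        using False by (simp add: matrix_vector_mult_scaleR power2_eq_square field_simps)
      also have "(y /\<^sub>R norm y) \<bullet> (E *v (y /\<^sub>R norm y)) = f T (y /\<^sub>R norm y)"
      proof -
        have "(y /\<^sub>R norm y) \<bullet> (y /\<^sub>R norm y) = 1"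
          using False by (subst norm_eq_1[symmetric]) simp
        then show ?thesis by (simp only: f_def Ev inner_diff_right inner_scaleR_right mult_1_right)
      qed
      finally show ?thesis using nonneg[of "y /\<^sub>R norm y"] False by simp
    qed simp
    have fT0: "f T u = 0" using nonneg[OF u] fTu by simp
    have "u \<bullet> (E *v u) = 0"
      using fT0 u by (simp add: f_def Ev inner_diff_right norm_eq_1)
    then have "(E *v u) \<bullet> (E *v u) = 0"
      using semidefinite_form_null[OF Esym subspace_UNIV Enn UNIV_I _ UNIV_I, of u "E *v u"] by simp
    then have eig: "C T *v u = l T *\<^sub>R u" by (simp add: Ev)
    have pdT: "sym_pos_def (C T)"
    proof (rule sym_pos_defI[OF sym[OF TI]])
      fix y :: "real^'n" assume "norm y = 1"
      then show "y \<bullet> (C T *v y) > 0" using nonneg[of y] lpos[of T] by (simp add: f_def)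
    qed
    let ?C' = "M T ** C T + C T ** transpose (M T) + (W T + transpose (W T))"
    have "((\<lambda>s. C s *v u) has_vector_derivative ?C' *v u) (at T within I)"
      by (rule bounded_linear.has_vector_derivative[OF bounded_bilinear.bounded_linear_left[OF bounded_bilinear_matrix_vector_mult] C[OF TI]])
    then have "((\<lambda>s. u \<bullet> (C s *v u)) has_real_derivative u \<bullet> (?C' *v u)) (at T within I)"
      unfolding has_real_derivative_iff_has_vector_derivative
      by (rule bounded_linear.has_vector_derivative[OF bounded_linear_inner_right])
    moreover have "(l has_real_derivative - L * l T) (at T within I)"
      unfolding l_def[abs_def] by (auto intro!: derivative_eq_intros)
    ultimately have der: "((\<lambda>s. f s u) has_real_derivative u \<bullet> (?C' *v u) - - L * l T) (at T within I)"
      unfolding f_def by (rule DERIV_diff)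
    have "u \<bullet> (?C' *v u) = u \<bullet> (M T *v (C T *v u)) + (C T *v u) \<bullet> (transpose (M T) *v u)
        + u \<bullet> (W T *v u) + u \<bullet> (transpose (W T) *v u)"
      unfolding matrix_vector_mult_add_rdistrib inner_add_right symmetric_inner[OF sym[OF TI]]
        matrix_vector_mul_assoc[symmetric] by simp
    \<comment> \<open>The eigenvector equation makes the drift contribution proportional to the
      barrier itself, which is why an exponential barrier works.\<close>
    also have "\<dots> = 2 * l T * (u \<bullet> (M T *v u)) + 2 * (u \<bullet> (W T *v u))"
      unfolding inner_transpose eig by (simp add: inner_commute matrix_vector_mult_scaleR)
    also have "\<dots> \<ge> 2 * l T * (- K)"
    proof -
      have "- K \<le> u \<bullet> (M T *v u)" using K[OF Tr, of u] u by (simp add: norm_eq_1)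
      then have "2 * l T * (- K) \<le> 2 * l T * (u \<bullet> (M T *v u))"
        using lpos[of T] by (intro mult_left_mono) auto
      then show ?thesis using W[OF TI pdT, of u] by linarith
    qed
    finally have "u \<bullet> (?C' *v u) - - L * l T \<ge> l T"
      by (simp add: L_def algebra_simps)
    then have "u \<bullet> (?C' *v u) - - L * l T > 0" using lpos[of T] by simp
    \<comment> \<open>A positive derivative at contact means that \<open>f\<close> was negative at
      \<open>u\<close> shortly before \<open>T\<close>, against the choice of
      \<open>T\<close>.\<close>
    from has_real_derivative_pos_inc_left[OF der this] obtain d where
      d: "d > 0" "\<And>h. h > 0 \<Longrightarrow> T - h \<in> I \<Longrightarrow> h < d \<Longrightarrow> f (T - h) u < f T u"
      by blast
    define h where "h = min (d / 2) T"
    have h: "h > 0" "h < d" "T - h \<in> {0..r}" using d(1) T0 Tr by (auto simp: h_def)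
    have "T - h \<in> I" using sub h(3) by (rule subsetD)
    then have "f (T - h) u < 0" using d(2)[OF h(1) _ h(2)] fT0 by simp
    moreover have "f (T - h) u > 0" using before[of "T - h" u] h u by simp
    ultimately show False by simp
  qed
  then show ?thesis
    using r0 lpos[of r] sym[OF r] by (intro sym_pos_defI) (force simp: f_def)+
qed

section \<open>Block matrices\<close>

lemma sum_UNIV_Plus: "(\<Sum>k\<in>UNIV. f k) = (\<Sum>i\<in>UNIV. f (Inl i)) + (\<Sum>i\<in>UNIV. f (Inr i))"
  for f :: "'a::finite + 'b::finite \<Rightarrow> 'c::comm_monoid_add"
  unfolding UNIV_Plus_UNIV[symmetric] by (subst sum.Plus) auto

lemma stack_nth [simp]: "stack q p $ Inl i = q $ i" "stack q p $ Inr i = p $ i"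
  by (simp_all add: stack_def)

lemma block_mat_nth [simp]:
  "block_mat P Q R S $ Inl i $ Inl j = P $ i $ j" "block_mat P Q R S $ Inl i $ Inr j = Q $ i $ j"
  "block_mat P Q R S $ Inr i $ Inl j = R $ i $ j" "block_mat P Q R S $ Inr i $ Inr j = S $ i $ j"
  by (simp_all add: block_mat_def)

lemma vec_eq_iff_Plus: "x = y \<longleftrightarrow> (\<forall>i. x $ Inl i = y $ Inl i) \<and> (\<forall>i. x $ Inr i = y $ Inr i)"
  unfolding vec_eq_iff by (metis sum.exhaust)

lemma block_mat_mult_vector:
  "block_mat P Q R S *v z = stack (P *v q_part z + Q *v p_part z) (R *v q_part z + S *v p_part z)"
  by (simp add: vec_eq_iff_Plus matrix_vector_mult_def sum_UNIV_Plus q_part_def p_part_def)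

lemma block_mat_mult:
  "block_mat P Q R S ** block_mat P' Q' R' S' =
    block_mat (P ** P' + Q ** R') (P ** Q' + Q ** S') (R ** P' + S ** R') (R ** Q' + S ** S')"
  by (simp add: vec_eq_iff_Plus matrix_matrix_mult_def sum_UNIV_Plus)

lemma transpose_block_mat:
  "transpose (block_mat P Q R S) = block_mat (transpose P) (transpose R) (transpose Q) (transpose S)"
  by (simp add: vec_eq_iff_Plus transpose_def)

lemma block_mat_add:
  "block_mat P Q R S + block_mat P' Q' R' S' = block_mat (P + P') (Q + Q') (R + R') (S + S')"
  by (simp add: vec_eq_iff_Plus)

lemma stack_add: "stack q p + stack q' p' = stack (q + q') (p + p')"
  by (simp add: vec_eq_iff_Plus)

lemma inner_stack: "x \<bullet> stack q p = q_part x \<bullet> q + p_part x \<bullet> p"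
  by (simp add: inner_vec_def sum_UNIV_Plus q_part_def p_part_def)

lemma q_part_stack [simp]: "q_part (stack q p) = q" and p_part_stack [simp]: "p_part (stack q p) = p"
  by (simp_all add: q_part_def p_part_def vec_eq_iff)

lemma stack_eq_0_iff [simp]: "stack q p = 0 \<longleftrightarrow> q = 0 \<and> p = 0"
  by (simp add: vec_eq_iff_Plus) (simp add: vec_eq_iff)

lemma bounded_linear_q_part: "bounded_linear q_part"
  by (intro linear_conv_bounded_linear[THEN iffD1] linearI) (simp_all add: q_part_def vec_eq_iff)

lemma block_mat_has_vector_derivative:
  assumes "(P has_vector_derivative P') (at t within T)" "(Q has_vector_derivative Q') (at t within T)"
    "(R has_vector_derivative R') (at t within T)" "(S has_vector_derivative S') (at t within T)"
  shows "((\<lambda>s. block_mat (P s) (Q s) (R s) (S s)) has_vector_derivative block_mat P' Q' R' S') (at t within T)"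
proof (rule matrix_has_vector_derivativeI)
  fix i j
  show "((\<lambda>s. block_mat (P s) (Q s) (R s) (S s) $ i $ j) has_real_derivative block_mat P' Q' R' S' $ i $ j)
      (at t within T)"
    using assms[THEN matrix_entry_has_real_derivative] by (cases i; cases j) simp_all
qed

lemma stack_has_vector_derivative:
  assumes q: "(q has_vector_derivative q') (at t within T)" and p: "(p has_vector_derivative p') (at t within T)"
  shows "((\<lambda>s. stack (q s) (p s)) has_vector_derivative stack q' p') (at t within T)"
proof -
  have "bounded_linear (\<lambda>q. stack q 0)" "bounded_linear (\<lambda>p. stack 0 p)"
    by (intro linear_conv_bounded_linear[THEN iffD1] linearI; simp add: vec_eq_iff_Plus)+
  then have "((\<lambda>s. stack (q s) 0 + stack 0 (p s)) has_vector_derivative stack q' 0 + stack 0 p') (at t within T)"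
    by (intro has_vector_derivative_add bounded_linear.has_vector_derivative[OF _ q] bounded_linear.has_vector_derivative[OF _ p])
  then show ?thesis by (simp add: stack_add)
qed

lemma sym_pos_def_q_block:
  assumes "sym_pos_def (block_mat P Q R S)"
  shows "sym_pos_def P"
proof -
  have "transpose P = P"
    using assms by (simp add: sym_pos_def_def transpose_block_mat vec_eq_iff_Plus) (simp add: vec_eq_iff)
  moreover have "x \<bullet> (P *v x) > 0" if "x \<noteq> 0" for x
  proof -
    have "stack x 0 \<bullet> (block_mat P Q R S *v stack x 0) > 0"
      using assms that by (simp add: sym_pos_def_def)
    then show ?thesis by (simp add: block_mat_mult_vector inner_stack)
  qed
  ultimately show ?thesis by (simp add: sym_pos_def_def)
qed

lemma block_mat_eq_iff:
  "block_mat P Q R S = block_mat P' Q' R' S' \<longleftrightarrow> P = P' \<and> Q = Q' \<and> R = R' \<and> S = S'"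
proof
  assume eq: "block_mat P Q R S = block_mat P' Q' R' S'"
  have "P $ i $ j = P' $ i $ j \<and> Q $ i $ j = Q' $ i $ j \<and> R $ i $ j = R' $ i $ j \<and> S $ i $ j = S' $ i $ j" for i j
    using arg_cong[OF eq, of "\<lambda>M. M $ Inl i $ Inl j"] arg_cong[OF eq, of "\<lambda>M. M $ Inl i $ Inr j"]
      arg_cong[OF eq, of "\<lambda>M. M $ Inr i $ Inl j"] arg_cong[OF eq, of "\<lambda>M. M $ Inr i $ Inr j"] by simp
  then show "P = P' \<and> Q = Q' \<and> R = R' \<and> S = S'" by (simp add: vec_eq_iff)
qed simp

text \<open>Serves twice: with \<open>z\<close> the mean it is the mean equation, and with arbitrary
  \<open>z\<close> it is the negative of the drift in the Fokker-Planck flux.\<close>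

lemma block_drift:
  "stack (p_part z) (- (S *v (R *v q_part z - c)) - \<gamma> *\<^sub>R p_part z) =
    block_mat 0 (mat 1) (- (S ** R)) (- (\<gamma> *\<^sub>R mat 1)) *v z + stack 0 (S *v c)"
  unfolding block_mat_mult_vector stack_add
  by (simp add: matrix_vector_mult_diff_distrib matrix_vector_mul_assoc
      bounded_bilinear.minus_left[OF bounded_bilinear_matrix_vector_mult] flip: scaleR_matrix_vector_assoc)
    (simp add: algebra_simps)

text \<open>Multiply out the blocks. Symmetry of \<open>S\<close> cancels the off-diagonal blocks of
  \<open>W + transpose W\<close> and leaves \<open>2 * \<gamma>\<close> times \<open>S\<close> in
  the momentum block.\<close>

lemma block_lyapunov_drift:
  fixes S T X R :: "real^'n^'n"  and \<gamma> :: real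
  assumes S: "transpose S = S" and T: "transpose T = T" and R: "transpose R = R"
  defines "M \<equiv> block_mat 0 (mat 1) (- (S ** R)) (- (\<gamma> *\<^sub>R mat 1))"
    and "C \<equiv> block_mat S X (transpose X) T"
    and "W \<equiv> block_mat 0 (- S) S (\<gamma> *\<^sub>R S)"
  shows "block_mat (X + transpose X) (- (\<gamma> *\<^sub>R X) - S ** R ** S + T)
      (transpose (- (\<gamma> *\<^sub>R X) - S ** R ** S + T))
      (- (S ** R ** X) - transpose (S ** R ** X) - (2 * \<gamma>) *\<^sub>R T + (2 * \<gamma>) *\<^sub>R S) =
    M ** C + C ** transpose M + (W + transpose W)"
proof -
  note mult = bounded_bilinear.minus_left[OF bounded_bilinear_matrix_matrix_mult]
    bounded_bilinear.minus_right[OF bounded_bilinear_matrix_matrix_mult]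
    bounded_bilinear.scaleR_left[OF bounded_bilinear_matrix_matrix_mult]
    bounded_bilinear.scaleR_right[OF bounded_bilinear_matrix_matrix_mult]
    bounded_bilinear.zero_left[OF bounded_bilinear_matrix_matrix_mult]
    bounded_bilinear.zero_right[OF bounded_bilinear_matrix_matrix_mult]
  have two: "(2 * \<gamma>) *\<^sub>R Y = \<gamma> *\<^sub>R Y + \<gamma> *\<^sub>R Y" for Y :: "real^'n^'n"
    by (simp add: scaleR_add_left[symmetric])
  show ?thesis
    unfolding M_def C_def W_def block_mat_mult transpose_block_mat block_mat_add block_mat_eq_iff
    by (simp add: transpose_simps mult matrix_transpose_mul S T R matrix_mul_assoc transpose_scalar two)
qed

text \<open>The q-part of \<open>m + P *v u\<close> uses only the upper rows \<open>L\<close> of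
  \<open>P\<close>, and \<open>L ** transpose L\<close> is the upper left block of
  \<open>P ** transpose P = C\<close>.\<close>

lemma gaussian_density_moments:
  fixes C :: "real^('n::finite + 'n)^('n + 'n)"
  assumes C: "sym_pos_def C"
  shows "probability_density (gaussian_density m C)"
    and "integrable (q_marginal (gaussian_density m C)) (\<lambda>q. (norm q)\<^sup>2)"
    and "q_covariance (gaussian_density m C) = (\<chi> i j. C $ Inl i $ Inl j)"
proof -
  obtain P :: "real^('n + 'n)^('n + 'n)" where P: "P ** transpose P = C"
    and G: "density lborel (\<lambda>z. ennreal (gaussian_density m C z)) = distr std_gaussian borel (\<lambda>u. m + P *v u)"
    using gaussian_density_pushforward[OF C, of m] by (elim exE conjE)
  have [measurable]: "(\<lambda>u. P *v u) \<in> borel_measurable borel" "q_part \<in> borel_measurable borel"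
    by (intro borel_measurable_continuous_onI linear_continuous_on matrix_vector_mul_bounded_linear
        bounded_linear_q_part)+
  have "transpose C = C" "det C \<noteq> 0"
    using C sym_pos_def_det_pos[OF C] by (auto simp: sym_pos_def_def)
  then have "continuous_on UNIV (gaussian_density m C)"
    by (intro continuous_at_imp_continuous_on ballI has_derivative_continuous[OF gaussian_density_has_derivative])
  then have [measurable]: "gaussian_density m C \<in> borel_measurable borel"
    by (rule borel_measurable_continuous_onI)
  interpret prob_space "std_gaussian :: (real^('n + 'n)) measure" by (rule prob_space_std_gaussian)
  have "(\<integral>\<^sup>+z. ennreal (gaussian_density m C z) \<partial>lborel) = emeasure (density lborel (\<lambda>z. ennreal (gaussian_density m C z))) UNIV"
    by (subst emeasure_density) auto
  also have "\<dots> = 1"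
    unfolding G by (subst emeasure_distr) (auto simp: emeasure_space_1[simplified])
  finally show "probability_density (gaussian_density m C)"
    by (simp add: probability_density_def gaussian_density_def[of m C])
  define L where "L = (\<chi> i k. P $ Inl i $ k)"
  have "q_part (m + P *v u) = q_part m + L *v u" for u
    by (simp add: q_part_def L_def vec_eq_iff matrix_vector_mult_def)
  then have M: "q_marginal (gaussian_density m C) = distr std_gaussian borel (\<lambda>u. q_part m + L *v u)"
    unfolding q_marginal_def G by (subst distr_distr) (auto simp: o_def)
  show "integrable (q_marginal (gaussian_density m C)) (\<lambda>q. (norm q)\<^sup>2)"
    unfolding M by (rule affine_std_gaussian)
  have "L ** transpose L = (\<chi> i j. (P ** transpose P) $ Inl i $ Inl j)"
    by (simp add: L_def matrix_matrix_mult_def transpose_def vec_eq_iff)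
  then show "q_covariance (gaussian_density m C) = (\<chi> i j. C $ Inl i $ Inl j)"
    unfolding M P by (simp only: affine_std_gaussian)
qed

theorem proposition5p3:
  fixes A :: "real^'n^'j" and y :: "real^'j"
    and \<Gamma> :: "real^'j^'j" and \<Gamma>\<^sub>0 :: "real^'n^'n"
    and \<gamma> :: real and B :: "real^'n^'n" and c :: "real^'n"
    and m\<^sub>0 :: "real^('n + 'n)" and C\<^sub>0 :: "real^('n + 'n)^('n + 'n)"
    and m\<^sub>q m\<^sub>p :: "real \<Rightarrow> real^'n"
    and C\<^sub>q C\<^sub>p C\<^sub>q\<^sub>p :: "real \<Rightarrow> real^'n^'n"
    and m :: "real \<Rightarrow> real^('n + 'n)" and C :: "real \<Rightarrow> real^('n + 'n)^('n + 'n)"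
    and I :: "real set"
    and \<rho>\<^sub>0 :: "real^('n + 'n) \<Rightarrow> real" and \<rho> :: "real \<Rightarrow> real^('n + 'n) \<Rightarrow> real"
  assumes Gamma: "sym_pos_def \<Gamma>" and Gamma0: "sym_pos_def \<Gamma>\<^sub>0" and C0: "sym_pos_def C\<^sub>0"
    and gamma: "\<gamma> > 0"
    and B: "B = matrix_inv (transpose A ** matrix_inv \<Gamma> ** A + matrix_inv \<Gamma>\<^sub>0)"
    and c: "c = (transpose A ** matrix_inv \<Gamma>) *v y"
    and I: "is_interval I" "0 \<in> I" "I \<subseteq> {0..}"
    and m: "\<And>t. m t = stack (m\<^sub>q t) (m\<^sub>p t)"
    and C: "\<And>t. C t = block_mat (C\<^sub>q t) (C\<^sub>q\<^sub>p t) (transpose (C\<^sub>q\<^sub>p t)) (C\<^sub>p t)"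
    and ode_mq: "\<And>t. t \<in> I \<Longrightarrow> (m\<^sub>q has_vector_derivative m\<^sub>p t) (at t within I)"
    and ode_mp: "\<And>t. t \<in> I \<Longrightarrow> (m\<^sub>p has_vector_derivative
          - (C\<^sub>q t *v (matrix_inv B *v m\<^sub>q t - c)) - \<gamma> *\<^sub>R m\<^sub>p t) (at t within I)"
    and ode_Cq: "\<And>t. t \<in> I \<Longrightarrow> (C\<^sub>q has_vector_derivative
          C\<^sub>q\<^sub>p t + transpose (C\<^sub>q\<^sub>p t)) (at t within I)"
    and ode_Cp: "\<And>t. t \<in> I \<Longrightarrow> (C\<^sub>p has_vector_derivative
          - (C\<^sub>q t ** matrix_inv B ** C\<^sub>q\<^sub>p t) - transpose (C\<^sub>q t ** matrix_inv B ** C\<^sub>q\<^sub>p t)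
          - (2 * \<gamma>) *\<^sub>R C\<^sub>p t + (2 * \<gamma>) *\<^sub>R C\<^sub>q t) (at t within I)"
    and ode_Cqp: "\<And>t. t \<in> I \<Longrightarrow> (C\<^sub>q\<^sub>p has_vector_derivative
          - (\<gamma> *\<^sub>R C\<^sub>q\<^sub>p t) - C\<^sub>q t ** matrix_inv B ** C\<^sub>q t + C\<^sub>p t) (at t within I)"
    and init: "m 0 = m\<^sub>0" "C 0 = C\<^sub>0"
    and rho0: "\<And>z. \<rho>\<^sub>0 z = gaussian_density m\<^sub>0 C\<^sub>0 z"
    and rho: "\<And>t z. \<rho> t z = gaussian_density (m t) (C t) z"
  shows "solves_fokker_planck \<gamma> B c I \<rho> \<and> (\<forall>z. \<rho> 0 z = \<rho>\<^sub>0 z)"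
proof -
  let ?R = "matrix_inv B"
  define X where "X = transpose A ** matrix_inv \<Gamma> ** A + matrix_inv \<Gamma>\<^sub>0"
  have "sym_pos_def X"
    unfolding X_def by (rule sym_pos_def_normal_matrix[OF Gamma Gamma0])
  then have "transpose X = X" "det X \<noteq> 0"
    using sym_pos_def_det_pos[of X] by (auto simp: sym_pos_def_def)
  then have R: "transpose ?R = ?R"
    unfolding B X_def[symmetric] by (simp add: matrix_inv_matrix_inv)
  have conv: "convex I" using I(1) by (rule is_interval_convex)
  have "transpose (C 0) = C 0" using C0 init by (simp add: sym_pos_def_def)
  then have sym0: "transpose (C\<^sub>q 0) = C\<^sub>q 0" "transpose (C\<^sub>p 0) = C\<^sub>p 0"
    unfolding C transpose_block_mat block_mat_eq_iff by auto

  \<comment> \<open>The right-hand side of the equation for \<open>C\<^sub>q\<close> is symmetric,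
    so the skew part of \<open>C\<^sub>q\<close> is constant in time and vanishes initially.\<close>
  have Cq_sym: "transpose (C\<^sub>q t) = C\<^sub>q t" if "t \<in> I" for t
  proof -
    have "C\<^sub>q t $ i $ j - C\<^sub>q t $ j $ i = C\<^sub>q 0 $ i $ j - C\<^sub>q 0 $ j $ i" for i j
    proof -
      have "((\<lambda>s. C\<^sub>q s $ i $ j - C\<^sub>q s $ j $ i) has_real_derivative 0) (at s within I)" if "s \<in> I" for s
        using DERIV_diff[OF matrix_entry_has_real_derivative[OF ode_Cq[OF that], of i j]
            matrix_entry_has_real_derivative[OF ode_Cq[OF that], of j i]]
        by (simp add: transpose_def)
      then have "\<exists>k. \<forall>s\<in>I. C\<^sub>q s $ i $ j - C\<^sub>q s $ j $ i = k"
        by (rule has_field_derivative_zero_constant[OF conv])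
      then show ?thesis using that I(2) by metis
    qed
    moreover have "C\<^sub>q 0 $ i $ j = C\<^sub>q 0 $ j $ i" for i j
      using arg_cong[OF sym0(1), of "\<lambda>M. M $ j $ i"] by (simp add: transpose_def)
    ultimately show ?thesis by (simp add: transpose_def vec_eq_iff)
  qed
  \<comment> \<open>With \<open>C\<^sub>q\<close> symmetric, the skew part of
    \<open>C\<^sub>p\<close> obeys a linear decay equation with rate \<open>2 * \<gamma>\<close>,
    and the exponential is its integrating factor.\<close>
  have Cp_sym: "transpose (C\<^sub>p t) = C\<^sub>p t" if "t \<in> I" for t
  proof -
    let ?a = "\<lambda>i j s. C\<^sub>p s $ i $ j - C\<^sub>p s $ j $ i"
    have "exp (2 * \<gamma> * t) * ?a i j t = exp (2 * \<gamma> * 0) * ?a i j 0" for i j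
    proof -
      have "((\<lambda>s. exp (2 * \<gamma> * s) * ?a i j s) has_real_derivative 0) (at s within I)" if s: "s \<in> I" for s
      proof -
        have "C\<^sub>q s $ i $ j = C\<^sub>q s $ j $ i"
          using arg_cong[OF Cq_sym[OF s], of "\<lambda>M. M $ j $ i"] by (simp add: transpose_def)
        then have a: "(?a i j has_real_derivative - (2 * \<gamma>) * ?a i j s) (at s within I)"
          using DERIV_diff[OF matrix_entry_has_real_derivative[OF ode_Cp[OF s], of i j]
              matrix_entry_has_real_derivative[OF ode_Cp[OF s], of j i]]
          by (simp add: transpose_def algebra_simps)
        have e: "((\<lambda>s. exp (2 * \<gamma> * s)) has_real_derivative 2 * \<gamma> * exp (2 * \<gamma> * s)) (at s within I)"
          by (auto intro!: derivative_eq_intros)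
        show ?thesis
          by (rule DERIV_cong[OF DERIV_mult[OF e a]]) (simp add: algebra_simps)
      qed
      then have "\<exists>k. \<forall>s\<in>I. exp (2 * \<gamma> * s) * ?a i j s = k"
        by (rule has_field_derivative_zero_constant[OF conv])
      then show ?thesis using that I(2) by metis
    qed
    moreover have "C\<^sub>p 0 $ i $ j = C\<^sub>p 0 $ j $ i" for i j
      using arg_cong[OF sym0(2), of "\<lambda>M. M $ j $ i"] by (simp add: transpose_def)
    ultimately show ?thesis by (simp add: transpose_def vec_eq_iff)
  qed

  define M where "M t = block_mat 0 (mat 1) (- (C\<^sub>q t ** ?R)) (- (\<gamma> *\<^sub>R mat 1))" for t
  define W where "W t = block_mat 0 (- C\<^sub>q t) (C\<^sub>q t) (\<gamma> *\<^sub>R C\<^sub>q t)" for t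
  have C_sym: "transpose (C t) = C t" if "t \<in> I" for t
    unfolding C transpose_block_mat by (simp add: Cq_sym Cp_sym that)
  have der_C: "(C has_vector_derivative M t ** C t + C t ** transpose (M t) + (W t + transpose (W t)))
      (at t within I)" if t: "t \<in> I" for t
  proof -
    have tr: "((\<lambda>s. transpose (C\<^sub>q\<^sub>p s)) has_vector_derivative
        transpose (- (\<gamma> *\<^sub>R C\<^sub>q\<^sub>p t) - C\<^sub>q t ** ?R ** C\<^sub>q t + C\<^sub>p t)) (at t within I)"
      by (rule matrix_has_vector_derivativeI)
        (use matrix_entry_has_real_derivative[OF ode_Cqp[OF t]] in \<open>simp add: transpose_def\<close>)
    have "(C has_vector_derivative block_mat (C\<^sub>q\<^sub>p t + transpose (C\<^sub>q\<^sub>p t))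
        (- (\<gamma> *\<^sub>R C\<^sub>q\<^sub>p t) - C\<^sub>q t ** ?R ** C\<^sub>q t + C\<^sub>p t)
        (transpose (- (\<gamma> *\<^sub>R C\<^sub>q\<^sub>p t) - C\<^sub>q t ** ?R ** C\<^sub>q t + C\<^sub>p t))
        (- (C\<^sub>q t ** ?R ** C\<^sub>q\<^sub>p t) - transpose (C\<^sub>q t ** ?R ** C\<^sub>q\<^sub>p t)
          - (2 * \<gamma>) *\<^sub>R C\<^sub>p t + (2 * \<gamma>) *\<^sub>R C\<^sub>q t)) (at t within I)"
      unfolding C[abs_def]
      by (rule block_mat_has_vector_derivative[OF ode_Cq[OF t] ode_Cqp[OF t] tr ode_Cp[OF t]])
    also have "block_mat (C\<^sub>q\<^sub>p t + transpose (C\<^sub>q\<^sub>p t))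
        (- (\<gamma> *\<^sub>R C\<^sub>q\<^sub>p t) - C\<^sub>q t ** ?R ** C\<^sub>q t + C\<^sub>p t)
        (transpose (- (\<gamma> *\<^sub>R C\<^sub>q\<^sub>p t) - C\<^sub>q t ** ?R ** C\<^sub>q t + C\<^sub>p t))
        (- (C\<^sub>q t ** ?R ** C\<^sub>q\<^sub>p t) - transpose (C\<^sub>q t ** ?R ** C\<^sub>q\<^sub>p t)
          - (2 * \<gamma>) *\<^sub>R C\<^sub>p t + (2 * \<gamma>) *\<^sub>R C\<^sub>q t) =
        M t ** C t + C t ** transpose (M t) + (W t + transpose (W t))"
      unfolding M_def W_def C
      by (rule block_lyapunov_drift[OF Cq_sym[OF t] Cp_sym[OF t] R])
    finally show ?thesis .
  qed
  have der_m: "(m has_vector_derivative M t *v m t + stack 0 (C\<^sub>q t *v c)) (at t within I)" if t: "t \<in> I" for t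
  proof -
    have "(m has_vector_derivative stack (m\<^sub>p t) (- (C\<^sub>q t *v (?R *v m\<^sub>q t - c)) - \<gamma> *\<^sub>R m\<^sub>p t)) (at t within I)"
      unfolding m[abs_def] by (rule stack_has_vector_derivative[OF ode_mq[OF t] ode_mp[OF t]])
    also have "stack (m\<^sub>p t) (- (C\<^sub>q t *v (?R *v m\<^sub>q t - c)) - \<gamma> *\<^sub>R m\<^sub>p t) = M t *v m t + stack 0 (C\<^sub>q t *v c)"
      using block_drift[of "m t" "C\<^sub>q t" ?R c \<gamma>] by (simp add: M_def m)
    finally show ?thesis .
  qed
  \<comment> \<open>Continuity supplies the uniform bound on the quadratic form of the drift over
    compact time intervals, from which the barrier rate is chosen.\<close>
  have cont_M: "continuous_on I M"
    unfolding continuous_on_eq_continuous_within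
  proof
    fix t assume t: "t \<in> I"
    have "((\<lambda>s. - (C\<^sub>q s ** ?R)) has_vector_derivative - ((C\<^sub>q\<^sub>p t + transpose (C\<^sub>q\<^sub>p t)) ** ?R)) (at t within I)"
      by (intro has_vector_derivative_minus bounded_linear.has_vector_derivative[OF
            bounded_bilinear.bounded_linear_left[OF bounded_bilinear_matrix_matrix_mult] ode_Cq[OF t]])
    from block_mat_has_vector_derivative[OF has_vector_derivative_const has_vector_derivative_const
        this has_vector_derivative_const]
    show "continuous (at t within I) M"
      unfolding M_def[abs_def] by (rule has_vector_derivative_continuous)
  qed
  \<comment> \<open>The off-diagonal blocks cancel in the quadratic form, and only the friction term
    in the momentum part remains.\<close>
  have W_nonneg: "0 \<le> x \<bullet> (W t *v x)" if "sym_pos_def (C t)" for t x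
  proof -
    have Cq: "sym_pos_def (C\<^sub>q t)" using that unfolding C by (rule sym_pos_def_q_block)
    then have "0 \<le> p_part x \<bullet> (C\<^sub>q t *v p_part x)"
      by (cases "p_part x = 0") (auto simp: sym_pos_def_def less_imp_le)
    moreover have "x \<bullet> (W t *v x) = \<gamma> * (p_part x \<bullet> (C\<^sub>q t *v p_part x))"
      using Cq symmetric_inner[of "C\<^sub>q t" "p_part x" "q_part x"]
      by (simp add: sym_pos_def_def W_def block_mat_mult_vector inner_stack inner_add_right inner_commute
          bounded_bilinear.minus_left[OF bounded_bilinear_matrix_vector_mult] flip: scaleR_matrix_vector_assoc)
    ultimately show ?thesis using gamma by simp
  qed
  have pd: "sym_pos_def (C t)" if "t \<in> I" for t
  proof (rule lyapunov_flow_pos_def[OF I der_C cont_M C_sym _ _ that])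
    show "sym_pos_def (C 0)" using C0 init by simp
  qed (use W_nonneg in auto)

  have rho_t: "\<rho> t = gaussian_density (m t) (C t)" for t by (rule ext) (rule rho)
  \<comment> \<open>This removes the nonlocality: the covariance functional evaluated at the profile
    is the matrix from the moment equations.\<close>
  have cov: "q_covariance (\<rho> t) = C\<^sub>q t" if "t \<in> I" for t
    unfolding rho_t gaussian_density_moments(3)[OF pd[OF that]] by (simp add: C vec_eq_iff)
  have field: "fokker_planck_field \<gamma> B c (\<rho> t) = (\<lambda>z. gaussian_density (m t) (C t) z *\<^sub>R
      (- (M t *v z + stack 0 (C\<^sub>q t *v c))) + W t *v grad (gaussian_density (m t) (C t)) z)" if "t \<in> I" for t
  proof
    fix z
    have "stack (- p_part z) (C\<^sub>q t *v (?R *v q_part z - c) + \<gamma> *\<^sub>R p_part z) =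
        - (M t *v z + stack 0 (C\<^sub>q t *v c))"
      unfolding M_def block_drift[symmetric] by (simp add: vec_eq_iff_Plus)
    then show "fokker_planck_field \<gamma> B c (\<rho> t) z = gaussian_density (m t) (C t) z *\<^sub>R
        (- (M t *v z + stack 0 (C\<^sub>q t *v c))) + W t *v grad (gaussian_density (m t) (C t)) z"
      unfolding fokker_planck_field_def cov[OF that] W_def unfolding rho_t by simp
  qed
  have "solves_fokker_planck \<gamma> B c I \<rho>"
    unfolding solves_fokker_planck_def
  proof (intro ballI conjI allI)
    fix t z assume t: "t \<in> I"
    note fp = gaussian_solves_linear_fokker_planck[OF der_m[OF t] der_C[OF t] pd t, of z]
    show "probability_density (\<rho> t)" "integrable (q_marginal (\<rho> t)) (\<lambda>q. (norm q)\<^sup>2)"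
      unfolding rho_t by (rule gaussian_density_moments[OF pd[OF t]])+
    have "transpose (C t) = C t" "det (C t) \<noteq> 0"
      using C_sym[OF t] sym_pos_def_det_pos[OF pd[OF t]] by auto
    then show "\<rho> t differentiable at z"
      unfolding rho_t by (rule differentiableI[OF gaussian_density_has_derivative])
    show "fokker_planck_field \<gamma> B c (\<rho> t) differentiable at z"
      unfolding field[OF t] by (rule fp(1))
    show "((\<lambda>s. \<rho> s z) has_real_derivative divergence (fokker_planck_field \<gamma> B c (\<rho> t)) z) (at t within I)"
      unfolding field[OF t] unfolding rho_t by (rule fp(2))
  qed
  moreover have "\<forall>z. \<rho> 0 z = \<rho>\<^sub>0 z" by (simp add: rho rho0 init)
  ultimately show ?thesis ..
qed

end
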